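(* Let $(X,d_X,\mu,T)$ and $(Y,d_Y,\nu,S)$ be compact metric measure-preserving systems and let $\lambda,\lambda'\in\mathcal J(T,S)$. If $\Phi_{n,m}(\lambda)=\Phi_{n,m}(\lambda')$ for every $n,m\ge1$, then the twin-free quotients $\mathcal K_\lambda^{\rm tw}$ and $\mathcal K_{\lambda'}^{\rm tw}$ are kernel-isomorphic. If, in addition, $\lambda$ and $\lambda'$ are distance-array pure, then there is a measure-space isomorphism $U:(X\times Y,\lambda)\to(X\times Y,\lambda')$ such that for all $a,b\ge0$: $M_X^{a,b}(z)=M_X^{a,b}(Uz)$ and $M_Y^{a,b}(z)=M_Y^{a,b}(Uz)$ for $\lambda$-a.e. $z$, and $K_X^{a,b}(z,z')=K_X^{a,b}(Uz,Uz')$ and $K_Y^{a,b}(z,z')=K_Y^{a,b}(Uz,Uz')$ for $\lambda\otimes\lambda$-a.e. $(z,z')$.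
   Context: A compact metric measure-preserving system $(X,d_X,\mu,T)$: $(X,d_X)$ compact metric, $\mu$ Borel probability, $T$ Borel with $T_\#\mu=\mu$; all probability spaces are standard and completed, equalities are modulo null sets. $\mathcal J(T,S)$ is the set of joinings: Borel probability measures on $X\times Y$ with marginals $\mu,\nu$ invariant under $T\times S$. For $z_i=(x_i,y_i)$, $\mathcal D^X_{n,m}=(d_X(T^ax_i,T^bx_j))_{1\le i,j\le n,0\le a,b<m}$, $\mathcal D^Y_{n,m}=(d_Y(S^ay_i,S^by_j))_{1\le i,j\le n,0\le a,b<m}$, and $\Phi_{n,m}(\lambda)=\mathrm{Law}_{\lambda^{\otimes n}}(\mathcal D^X_{n,m},\mathcal D^Y_{n,m})$. For $\lambda\in\mathcal J(T,S)$, $\mathcal K_\lambda$ is the marked colored kernel space on $(X\times Y,\lambda)$ with marks $M_X^{a,b}(x,y)=d_X(T^ax,T^bx)$, $M_Y^{a,b}(x,y)=d_Y(S^ay,S^by)$ and kernels $K_X^{a,b}((x,y),(x',y'))=d_X(T^ax,T^bx')$, $K_Y^{a,b}((x,y),(x',y'))=d_Y(S^ay,S^by')$, $a,b\ge0$. In a marked colored kernel space $(\Omega,\rho,(m_\alpha),(k_c))$ (countably many bounded measurable marks $m_\alpha:\Omega\to\mathbb R$ and kernels $k_c:\Omega^2\to\mathbb R$), points $z,z'$ are twins if all marks agree at $z,z'$ and for every $c$, $k_c(z,w)=k_c(z',w)$ and $k_c(w,z)=k_c(w,z')$ for $\rho$-a.e. $w$; the space is row-column-mark pure if, after discarding a null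 set, no two distinct points are twins. $\lambda$ is distance-array pure if $\mathcal K_\lambda$ is row-column-mark pure. The twin-free quotient $\mathcal K^{\rm tw}$ is the row-column-mark pure marked colored kernel space obtained (modulo null sets) by identifying twins, with the pushforward measure and the marks and kernels descended to the quotient. Two marked colored kernel spaces are kernel-isomorphic if a measure-space isomorphism $U$ between them preserves each mark a.e. and each kernel $\rho\otimes\rho$-a.e. *)

theory Defs
  imports "HOL-Probability.Probability"
begin

text \<open>The metric d_X is the metric dist of the type; the measure lives on the Borel sets.\<close>

definition cmmps :: "'a::metric_space measure \<Rightarrow> ('a \<Rightarrow> 'a) \<Rightarrow> bool" where
  "cmmps \<mu> T \<longleftrightarrow> compact (UNIV :: 'a set) \<and> sets \<mu> = sets borel \<and> prob_space \<mu>
     \<and> T \<in> measurable borel borel \<and> distr \<mu> borel T = \<mu>"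

definition joinings ::
  "'a::metric_space measure \<Rightarrow> ('a \<Rightarrow> 'a) \<Rightarrow> 'b::metric_space measure \<Rightarrow> ('b \<Rightarrow> 'b)
     \<Rightarrow> ('a \<times> 'b) measure set" where
  "joinings \<mu> T \<nu> S = {L. sets L = sets borel \<and> prob_space L
     \<and> distr L borel fst = \<mu> \<and> distr L borel snd = \<nu>
     \<and> distr L borel (map_prod T S) = L}"

text \<open>Index set for arrays: (i,j,a,b) with i,j < n (points, 0-based) and a,b < m (times).\<close>

definition arr_idx :: "nat \<Rightarrow> nat \<Rightarrow> (nat \<times> nat \<times> nat \<times> nat) set" where
  "arr_idx n m = {..<n} \<times> {..<n} \<times> {..<m} \<times> {..<m}"

definition DX :: "('a::metric_space \<Rightarrow> 'a) \<Rightarrow> nat \<Rightarrow> nat \<Rightarrow> (nat \<Rightarrow> 'a \<times> 'b)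
     \<Rightarrow> (nat \<times> nat \<times> nat \<times> nat) \<Rightarrow> real" where
  "DX T n m zs = restrict (\<lambda>(i,j,a,b). dist ((T ^^ a) (fst (zs i))) ((T ^^ b) (fst (zs j)))) (arr_idx n m)"

definition DY :: "('b::metric_space \<Rightarrow> 'b) \<Rightarrow> nat \<Rightarrow> nat \<Rightarrow> (nat \<Rightarrow> 'a \<times> 'b)
     \<Rightarrow> (nat \<times> nat \<times> nat \<times> nat) \<Rightarrow> real" where
  "DY S n m zs = restrict (\<lambda>(i,j,a,b). dist ((S ^^ a) (snd (zs i))) ((S ^^ b) (snd (zs j)))) (arr_idx n m)"

definition array_space :: "nat \<Rightarrow> nat \<Rightarrow> (((nat \<times> nat \<times> nat \<times> nat) \<Rightarrow> real) \<times> ((nat \<times> nat \<times> nat \<times> nat) \<Rightarrow> real)) measure" where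
  "array_space n m = PiM (arr_idx n m) (\<lambda>_. borel) \<Otimes>\<^sub>M PiM (arr_idx n m) (\<lambda>_. borel)"

definition Phi :: "('a::metric_space \<Rightarrow> 'a) \<Rightarrow> ('b::metric_space \<Rightarrow> 'b) \<Rightarrow> nat \<Rightarrow> nat
     \<Rightarrow> ('a \<times> 'b) measure \<Rightarrow> _ measure" where
  "Phi T S n m L = distr (PiM {..<n} (\<lambda>_. L)) (array_space n m) (\<lambda>zs. (DX T n m zs, DY S n m zs))"

definition mck_space :: "'o measure \<Rightarrow> ('i::countable \<Rightarrow> 'o \<Rightarrow> real) \<Rightarrow> ('j::countable \<Rightarrow> 'o \<Rightarrow> 'o \<Rightarrow> real) \<Rightarrow> bool" where
  "mck_space \<rho> mk kn \<longleftrightarrow> prob_space \<rho>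
     \<and> (\<forall>\<alpha>. mk \<alpha> \<in> borel_measurable \<rho> \<and> bounded (mk \<alpha> ` space \<rho>))
     \<and> (\<forall>c. (\<lambda>p. kn c (fst p) (snd p)) \<in> borel_measurable (\<rho> \<Otimes>\<^sub>M \<rho>)
           \<and> bounded ((\<lambda>p. kn c (fst p) (snd p)) ` space (\<rho> \<Otimes>\<^sub>M \<rho>)))"

definition twins :: "'o measure \<Rightarrow> ('i \<Rightarrow> 'o \<Rightarrow> real) \<Rightarrow> ('j \<Rightarrow> 'o \<Rightarrow> 'o \<Rightarrow> real) \<Rightarrow> 'o \<Rightarrow> 'o \<Rightarrow> bool" where
  "twins \<rho> mk kn z z' \<longleftrightarrow> (\<forall>\<alpha>. mk \<alpha> z = mk \<alpha> z')
     \<and> (\<forall>c. AE w in \<rho>. kn c z w = kn c z' w)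
     \<and> (\<forall>c. AE w in \<rho>. kn c w z = kn c w z')"

definition rcm_pure :: "'o measure \<Rightarrow> ('i \<Rightarrow> 'o \<Rightarrow> real) \<Rightarrow> ('j \<Rightarrow> 'o \<Rightarrow> 'o \<Rightarrow> real) \<Rightarrow> bool" where
  "rcm_pure \<rho> mk kn \<longleftrightarrow> (\<exists>N \<in> null_sets \<rho>. \<forall>z \<in> space \<rho> - N. \<forall>z' \<in> space \<rho> - N.
      twins \<rho> mk kn z z' \<longrightarrow> z = z')"

definition meas_iso :: "'o measure \<Rightarrow> 'p measure \<Rightarrow> ('o \<Rightarrow> 'p) \<Rightarrow> bool" where
  "meas_iso \<rho> \<rho>' U \<longleftrightarrow> U \<in> measurable \<rho> \<rho>' \<and> distr \<rho> \<rho>' U = \<rho>' \<and>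
     (\<exists>V. V \<in> measurable \<rho>' \<rho> \<and> distr \<rho>' \<rho> V = \<rho>
        \<and> (AE z in \<rho>. V (U z) = z) \<and> (AE z' in \<rho>'. U (V z') = z'))"

definition kernel_iso :: "'o measure \<Rightarrow> ('i \<Rightarrow> 'o \<Rightarrow> real) \<Rightarrow> ('j \<Rightarrow> 'o \<Rightarrow> 'o \<Rightarrow> real)
    \<Rightarrow> 'p measure \<Rightarrow> ('i \<Rightarrow> 'p \<Rightarrow> real) \<Rightarrow> ('j \<Rightarrow> 'p \<Rightarrow> 'p \<Rightarrow> real) \<Rightarrow> bool" where
  "kernel_iso \<rho> mk kn \<rho>' mk' kn' \<longleftrightarrow> (\<exists>U. meas_iso \<rho> \<rho>' U
     \<and> (\<forall>\<alpha>. AE z in \<rho>. mk \<alpha> z = mk' \<alpha> (U z))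
     \<and> (\<forall>c. AE p in \<rho> \<Otimes>\<^sub>M \<rho>. kn c (fst p) (snd p) = kn' c (U (fst p)) (U (snd p))))"

definition twin_free_quotient :: "'o measure \<Rightarrow> ('i::countable \<Rightarrow> 'o \<Rightarrow> real) \<Rightarrow> ('j::countable \<Rightarrow> 'o \<Rightarrow> 'o \<Rightarrow> real)
    \<Rightarrow> ('o \<Rightarrow> 'p) \<Rightarrow> 'p measure \<Rightarrow> ('i \<Rightarrow> 'p \<Rightarrow> real) \<Rightarrow> ('j \<Rightarrow> 'p \<Rightarrow> 'p \<Rightarrow> real) \<Rightarrow> bool" where
  "twin_free_quotient \<rho> mk kn q \<rho>' mk' kn' \<longleftrightarrow>
     mck_space \<rho>' mk' kn' \<and> rcm_pure \<rho>' mk' kn'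
     \<and> q \<in> measurable \<rho> \<rho>' \<and> distr \<rho> \<rho>' q = \<rho>'
     \<and> (\<exists>N \<in> null_sets \<rho>. \<forall>z \<in> space \<rho> - N. \<forall>z' \<in> space \<rho> - N.
           q z = q z' \<longleftrightarrow> twins \<rho> mk kn z z')
     \<and> (\<forall>\<alpha>. AE z in \<rho>. mk \<alpha> z = mk' \<alpha> (q z))
     \<and> (\<forall>c. AE p in \<rho> \<Otimes>\<^sub>M \<rho>. kn c (fst p) (snd p) = kn' c (q (fst p)) (q (snd p)))"

definition markK :: "('a::metric_space \<Rightarrow> 'a) \<Rightarrow> ('b::metric_space \<Rightarrow> 'b)
     \<Rightarrow> bool \<times> nat \<times> nat \<Rightarrow> 'a \<times> 'b \<Rightarrow> real" where
  "markK T S = (\<lambda>(isX, a, b) (x, y).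
     if isX then dist ((T ^^ a) x) ((T ^^ b) x) else dist ((S ^^ a) y) ((S ^^ b) y))"

definition kerK :: "('a::metric_space \<Rightarrow> 'a) \<Rightarrow> ('b::metric_space \<Rightarrow> 'b)
     \<Rightarrow> bool \<times> nat \<times> nat \<Rightarrow> 'a \<times> 'b \<Rightarrow> 'a \<times> 'b \<Rightarrow> real" where
  "kerK T S = (\<lambda>(isX, a, b) (x, y) (x', y').
     if isX then dist ((T ^^ a) x) ((T ^^ b) x') else dist ((S ^^ a) y) ((S ^^ b) y'))"

definition da_pure :: "('a::metric_space \<Rightarrow> 'a) \<Rightarrow> ('b::metric_space \<Rightarrow> 'b) \<Rightarrow> ('a \<times> 'b) measure \<Rightarrow> bool" where
  "da_pure T S L \<longleftrightarrow> rcm_pure L (markK T S) (kerK T S)"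

end

theory Submission
  imports Defs
begin

text \<open>The profile of a point z relative to an i.i.d. sample u consists of the marks of z together
  with all kernel values between z and the points of u. By the law of large numbers, applied to
  the kernels times indicators of a countable generator, almost every sample has a profile map
  that separates non-twins off a null set, so on a pure space it is injective off a null set.
  Sampling further pairs of points, the law of large numbers also shows that the joint law of the
  two profiles and the kernel values of a random pair is a function of the sampled array. When
  the arrays of two spaces have the same law, a compactness argument on graphs yields one good
  sample in each space with identical arrays, and the isomorphism is the profile map of the first
  followed by the inverse profile map of the second. Joinings are reduced to Polish spaces by
  embedding the compact metric space into a sequence space through distances to a dense sequence.\<close>

subsection \<open>Law of large numbers and inner regularity\<close>

text \<open>Equality of laws does not by itself provide a common sample. Good samples have full
  measure on either side, but the arrays of good samples need not form a measurable set; hence the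
  search for compact sets of array values of mass above 1/2 on both sides, which must meet. A single
  matched array serves two purposes: the points \<open>u\<close> act as coordinates for all other
  points, and independent pairs reveal the law of a pair in these coordinates. The law of one
  profile alone gives a measure isomorphism that matches marks, but it does not mention the kernel
  between two fresh points; this is why kernel values are part of the sampled law. Twin-free
  quotients are not constructed: any quotient on a Polish space inherits the law of the sample
  array, so one reconstruction result serves both claims.\<close>

instance prod :: (polish_space, polish_space) polish_space ..

text \<open>Hoeffding's inequality makes the probability of an \<epsilon>-deviation at time
  \<open>n\<close> decay geometrically, so Borel-Cantelli applies for each fixed \<epsilon>, and the
  countably many values \<open>1 / Suc k\<close> give convergence.\<close>

lemma bounded_slln:
  fixes f :: "'a \<Rightarrow> real"
  assumes "prob_space M" and [measurable]: "f \<in> borel_measurable M"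
    and bd: "\<And>x. x \<in> space M \<Longrightarrow> \<bar>f x\<bar> \<le> B"
  shows "AE w in PiM UNIV (\<lambda>_::nat. M). (\<lambda>n. (\<Sum>i<n. f (w i)) / real n) \<longlonglongrightarrow> (\<integral>x. f x \<partial>M)"
proof -
  interpret M: prob_space M by fact
  let ?P = "PiM UNIV (\<lambda>_::nat. M)"
  interpret P: product_prob_space "\<lambda>_. M" "UNIV :: nat set" by unfold_locales
  \<comment> \<open>The added 1 keeps the interval \<open>{-C..C}\<close> nondegenerate, so the
    denominator in the Hoeffding exponent is nonzero whatever \<open>B\<close> is.\<close>
  define C where "C = \<bar>B\<bar> + 1"
  have C: "C > 0" "\<And>x. x \<in> space M \<Longrightarrow> f x \<in> {-C..C}"
    using bd by (force simp: C_def)+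
  have "P.indep_vars (\<lambda>_. M) (\<lambda>i w. w i) (UNIV :: nat set)"
  proof (subst P.indep_vars_iff_distr_eq_PiM')
    have "distr ?P ?P (\<lambda>x. \<lambda>i\<in>UNIV. x i) = ?P"
      by (simp add: restrict_UNIV distr_id)
    moreover have "(\<Pi>\<^sub>M i\<in>(UNIV::nat set). distr ?P M (\<lambda>w. w i)) = ?P"
      by (intro PiM_cong refl) (simp add: P.PiM_component)
    ultimately show "distr ?P ?P (\<lambda>x. \<lambda>i\<in>UNIV. x i) = (\<Pi>\<^sub>M i\<in>UNIV. distr ?P M (\<lambda>w. w i))"
      by simp
  qed auto
  then have ind: "P.indep_vars (\<lambda>_. borel) (\<lambda>i w. f (w i)) (UNIV :: nat set)"
    by (rule P.indep_vars_compose2) auto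
  have dc: "distr ?P borel (\<lambda>w. f (w i)) = distr M borel f" for i :: nat
  proof -
    have "distr ?P borel (\<lambda>w. f (w i)) = distr (distr ?P M (\<lambda>w. w i)) borel f"
      by (subst distr_distr) (auto simp: comp_def)
    then show ?thesis by (simp add: P.PiM_component)
  qed
  have ex: "P.expectation (\<lambda>w. f (w 0)) = (\<integral>x. f x \<partial>M)"
  proof -
    have "(\<integral>x. f x \<partial>M) = (\<integral>x. f x \<partial>distr ?P M (\<lambda>w. w 0))"
      by (simp add: P.PiM_component)
    also have "\<dots> = P.expectation (\<lambda>w. f (w 0))"
      by (rule integral_distr) auto
    finally show ?thesis by simp
  qed
  have iid: "Hoeffding_ineq_iid ?P {..<n} (\<lambda>i w. f (w i)) (\<lambda>w. f (w 0)) (-C) C" for n :: nat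
  proof (unfold_locales, goal_cases)
    case 2 show ?case by (rule P.indep_vars_subset[OF ind]) auto
  next
    case (5)
    show ?case by (rule AE_I2, rule C(2)) (auto simp: space_PiM)
  qed (auto simp: dc)
  let ?m = "\<integral>x. f x \<partial>M"
  define A where "A \<epsilon> n = {w\<in>space ?P. \<bar>(\<Sum>i<n. f (w i)) / real n - ?m\<bar> \<ge> \<epsilon>}" for \<epsilon> n
  have [measurable]: "A \<epsilon> n \<in> sets ?P" for \<epsilon> n
    unfolding A_def by measurable
  have le: "measure ?P (A \<epsilon> n) \<le> 2 * exp (-2 * n * \<epsilon>\<^sup>2 / (C - (-C))\<^sup>2)" if "\<epsilon> > 0" "n > 0" for \<epsilon> n
  proof -
    interpret H: Hoeffding_ineq_iid ?P "{..<n}" "\<lambda>i w. f (w i)" "\<lambda>w. f (w 0)" "-C" C "?m"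
      rewrites "P.expectation (\<lambda>w. f (w 0)) = ?m"
      using iid[of n] by (auto simp: ex Hoeffding_ineq_iid_def)
    show ?thesis
      using H.Hoeffding_ineq_abs_ge'[of \<epsilon>] that C by (simp add: A_def lessThan_empty_iff)
  qed
  have ev: "AE w in ?P. eventually (\<lambda>n. w \<in> space ?P - A \<epsilon> n) sequentially" if e: "\<epsilon> > 0" for \<epsilon>
  proof (rule borel_cantelli_AE1)
    \<comment> \<open>For this \<open>r\<close> the Hoeffding bound is \<open>2 * r ^ n\<close>, a
      term of a geometric series.\<close>
    define r where "r = exp (- (2 * \<epsilon>\<^sup>2 / (2*C)\<^sup>2))"
    have r: "0 < r" "r < 1" using e C by (auto simp: r_def)
    have rn: "exp (-2 * real n * \<epsilon>\<^sup>2 / (C - (-C))\<^sup>2) = r ^ n" for n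
      unfolding r_def exp_of_nat_mult[symmetric] by (simp add: field_simps)
    have "summable (\<lambda>n. 2 * r ^ n)"
      using r by (intro summable_mult summable_geometric) auto
    then show "summable (\<lambda>n. measure ?P (A \<epsilon> n))"
    proof (rule summable_comparison_test[rotated], intro exI[of _ 1] allI impI)
      fix n :: nat assume "1 \<le> n"
      then show "norm (measure ?P (A \<epsilon> n)) \<le> 2 * r ^ n"
        using le[OF e, of n] rn[of n] by simp
    qed
  qed (auto simp: P.emeasure_eq_measure)
  have "AE w in ?P. \<forall>k. eventually (\<lambda>n. w \<in> space ?P - A (1 / Suc k) n) sequentially"
    unfolding AE_all_countable by (intro allI ev) simp
  then show ?thesis
  proof (rule AE_mp, intro AE_I2 impI)
    fix w assume w: "w \<in> space ?P" "\<forall>k. eventually (\<lambda>n. w \<in> space ?P - A (1 / Suc k) n) sequentially"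
    show "(\<lambda>n. (\<Sum>i<n. f (w i)) / real n) \<longlonglongrightarrow> ?m"
    proof (rule tendstoI)
      fix e :: real assume "e > 0"
      then obtain k where k: "1 / real (Suc k) < e"
        using nat_approx_posE by blast
      from w(2) have "eventually (\<lambda>n. w \<in> space ?P - A (1 / Suc k) n) sequentially" by blast
      then show "\<forall>\<^sub>F n in sequentially. dist ((\<Sum>i<n. f (w i)) / real n) ?m < e"
      proof eventually_elim
        case (elim n)
        then have "\<bar>(\<Sum>i<n. f (w i)) / real n - ?m\<bar> < 1 / Suc k"
          by (auto simp: A_def not_le)
        then show ?case using k by (simp add: dist_real_def)
      qed
    qed
  qed
qed

section \<open>Compact approximation, matching points and Borel inverses\<close>

lemma compact_inner_approx:
  fixes M :: "'a::polish_space measure"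
  assumes "sets M = sets borel" "prob_space M" "B \<in> sets borel" "emeasure M B = 1" "c < 1"
  obtains K where "compact K" "K \<subseteq> B" "measure M K > c"
proof -
  interpret prob_space M by fact
  have "emeasure M B = (SUP K \<in> {K. K \<subseteq> B \<and> compact K}. emeasure M K)"
    using assms(1,3) by (intro inner_regular) auto
  then have "ennreal c < (SUP K \<in> {K. K \<subseteq> B \<and> compact K}. emeasure M K)"
    using assms(4,5) by simp
  then obtain K where K: "K \<subseteq> B" "compact K" "ennreal c < emeasure M K"
    by (auto simp: less_SUP_iff)
  then have "c < measure M K"
    by (metis emeasure_eq_measure ennreal_leI not_le)
  with K that show ?thesis by blast
qed

lemma graph_in_borel:
  fixes f :: "'a::second_countable_topology \<Rightarrow> 'b::{second_countable_topology, metric_space}"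
  assumes [measurable]: "f \<in> borel_measurable borel" "G \<in> sets borel"
  shows "{p. fst p \<in> G \<and> f (fst p) = snd p} \<in> sets (borel :: ('a \<times> 'b) measure)"
proof -
  have "{p. fst p \<in> G \<and> f (fst p) = snd p}
      = {p \<in> space (borel \<Otimes>\<^sub>M borel). fst p \<in> G \<and> dist (f (fst p)) (snd p) = 0}"
    by (auto simp: space_pair_measure)
  also have "\<dots> \<in> sets (borel \<Otimes>\<^sub>M borel)"
    by measurable
  finally show ?thesis unfolding borel_prod .
qed

lemma graph_emeasure:
  fixes M :: "'a::polish_space measure" and f :: "'a \<Rightarrow> 'b::polish_space"
  assumes M: "sets M = sets borel" "prob_space M" and f: "f \<in> borel_measurable borel"
    and G: "G \<in> sets borel" "emeasure M G = 1"
  defines "D \<equiv> distr M borel (\<lambda>x. (x, f x))"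
  shows "sets D = sets borel" "prob_space D" "emeasure D {p. fst p \<in> G \<and> f (fst p) = snd p} = 1"
    "C \<in> sets borel \<Longrightarrow> emeasure D C = emeasure M {x. (x, f x) \<in> C}"
proof -
  interpret prob_space M by fact
  note [measurable_cong] = M(1)
  note [measurable] = f
  have m[measurable]: "(\<lambda>x. (x, f x)) \<in> M \<rightarrow>\<^sub>M (borel :: ('a \<times> 'b) measure)"
    unfolding borel_prod[symmetric] by measurable
  show "sets D = sets borel" "prob_space D"
    unfolding D_def by (simp, rule prob_space_distr[OF m])
  show *: "emeasure D C = emeasure M {x. (x, f x) \<in> C}" if "C \<in> sets borel" for C
    unfolding D_def using that
    by (subst emeasure_distr[OF m]) (auto intro!: arg_cong[where f="emeasure M"] simp: sets_eq_imp_space_eq[OF M(1)])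
  show "emeasure D {p. fst p \<in> G \<and> f (fst p) = snd p} = 1"
    using G by (subst *[OF graph_in_borel[OF f G(1)]]) simp
qed

text \<open>\<open>P\<close> may be nonmeasurable, whereas inner regularity needs a Borel set to
  exhaust.\<close>

lemma AE_borel_conull:
  fixes M :: "'a::topological_space measure"
  assumes "sets M = sets borel" "prob_space M" "AE x in M. P x"
  obtains G where "G \<in> sets borel" "emeasure M G = 1" "\<And>x. x \<in> G \<Longrightarrow> P x"
proof -
  interpret prob_space M by fact
  from assms(3) obtain N where N: "N \<in> null_sets M" "{x \<in> space M. \<not> P x} \<subseteq> N"
    by (metis eventually_ae_filter)
  show ?thesis
  proof
    show "space M - N \<in> sets borel" using N assms(1) by auto
    show "emeasure M (space M - N) = 1"
      using N by (simp add: emeasure_Diff_null_set emeasure_space_1)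
  qed (use N in auto)
qed

text \<open>Images of Borel sets under Borel maps need not be Borel; compact subsets of the graphs
  have compact projections, which avoids analytic sets.\<close>

lemma matching_points:
  fixes M :: "'a::polish_space measure" and N :: "'b::polish_space measure"
    and f :: "'a \<Rightarrow> 'c::polish_space" and g :: "'b \<Rightarrow> 'c"
  assumes M: "sets M = sets borel" "prob_space M" and N: "sets N = sets borel" "prob_space N"
    and f: "f \<in> borel_measurable borel" and g: "g \<in> borel_measurable borel"
    and eq: "distr M borel f = distr N borel g"
    and P: "AE x in M. P x" and Q: "AE y in N. Q y"
  obtains x y where "P x" "Q y" "f x = g y"
proof -
  \<comment> \<open>Two compact sets of mass above 1/2 under the common law cannot be disjoint. Each
    consists of values taken at points with the wanted property, being the projection of a compact
    piece of the graph over a Borel set of such points.\<close>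
  have half: "\<exists>K. compact K \<and> measure (distr L borel h) K > 1/2 \<and> (\<forall>z\<in>K. \<exists>x. R x \<and> h x = z)"
    if L: "sets L = sets borel" "prob_space L" and h: "h \<in> borel_measurable borel" and R: "AE x in L. R x"
    for L :: "'d::polish_space measure" and h :: "'d \<Rightarrow> 'c" and R
  proof -
    interpret prob_space L by fact
    from AE_borel_conull[OF L R] obtain G where G: "G \<in> sets borel" "emeasure L G = 1" "\<And>x. x \<in> G \<Longrightarrow> R x"
      by metis
    let ?D = "distr L borel (\<lambda>x. (x, h x))"
    note D = graph_emeasure[OF L h G(1,2)]
    obtain K where K: "compact K" "K \<subseteq> {p. fst p \<in> G \<and> h (fst p) = snd p}" "measure ?D K > 1/2"
      using compact_inner_approx[OF D(1,2) graph_in_borel[OF h G(1)] D(3), of "1/2"] by auto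
    have hL: "h \<in> borel_measurable L" using h L(1) measurable_cong_sets by blast
    have c: "compact (snd ` K)" by (intro compact_continuous_image continuous_intros K)
    have "measure ?D K = measure L {x. (x, h x) \<in> K}"
      using D(4)[OF borel_compact[OF K(1)]] by (simp add: measure_def)
    also have "\<dots> \<le> measure L (h -` (snd ` K) \<inter> space L)"
    proof (rule finite_measure_mono)
      show "h -` snd ` K \<inter> space L \<in> events"
        by (rule measurable_sets[OF hL]) (rule borel_compact[OF c])
    qed (force simp: sets_eq_imp_space_eq[OF L(1)])
    also have "\<dots> = measure (distr L borel h) (snd ` K)"
      using c by (subst measure_distr[OF hL]) (auto intro: borel_compact)
    finally show ?thesis using c K by (intro exI[of _ "snd ` K"]) (auto 0 4 dest!: subsetD[OF K(2)] intro: G(3))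
  qed
  from half[OF M f P] obtain K where K: "compact K" "measure (distr M borel f) K > 1/2"
    "\<And>z. z \<in> K \<Longrightarrow> \<exists>x. P x \<and> f x = z" by blast
  from half[OF N g Q] obtain K' where K': "compact K'" "measure (distr M borel f) K' > 1/2"
    "\<And>z. z \<in> K' \<Longrightarrow> \<exists>x. Q x \<and> g x = z" unfolding eq by blast
  interpret D: prob_space "distr M borel f"
    by (rule prob_space.prob_space_distr[OF M(2)]) (use f M(1) measurable_cong_sets in blast)
  have "K \<inter> K' \<noteq> {}"
  proof
    assume "K \<inter> K' = {}"
    then have "measure (distr M borel f) (K \<union> K') = measure (distr M borel f) K + measure (distr M borel f) K'"
      by (intro D.finite_measure_Union) (auto intro: borel_compact K K')
    with K(2) K'(2) D.prob_le_1[of "K \<union> K'"] show False by linarith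
  qed
  then obtain z where "z \<in> K" "z \<in> K'" by blast
  with K(3) K'(3) that show ?thesis by metis
qed

text \<open>Compact pieces of the graph over the complement of \<open>N\<close> exhaust
  \<open>M\<close> up to a null set. Their union, read backwards, is again the graph of a function
  because \<open>f\<close> is injective there, and closed sets pull back to countable unions of
  compact projections. The inverse is correct only almost everywhere, which suffices for an
  isomorphism modulo null sets.\<close>

lemma borel_left_inverse:
  fixes M :: "'a::polish_space measure" and f :: "'a \<Rightarrow> 'b::polish_space"
  assumes M: "sets M = sets borel" "prob_space M" and f: "f \<in> borel_measurable borel"
    and N: "N \<in> null_sets M" and inj: "inj_on f (- N)"
  obtains g where "g \<in> borel_measurable borel" "AE x in M. g (f x) = x"
proof -
  interpret prob_space M by fact
  have sM: "space M = UNIV" by (simp add: sets_eq_imp_space_eq[OF M(1)])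
  define G where "G = - N"
  have G: "G \<in> sets borel" "emeasure M G = 1"
  proof -
    have "N \<in> sets borel" using null_setsD2[OF N] unfolding M(1) .
    then show "G \<in> sets borel" unfolding G_def by (rule borel_comp)
    have "emeasure M (space M - N) = 1"
      using emeasure_Diff_null_set[OF N sets.top] emeasure_space_1 by simp
    then show "emeasure M G = 1" unfolding G_def sM Compl_eq_Diff_UNIV .
  qed
  let ?\<Gamma> = "{p. fst p \<in> G \<and> f (fst p) = snd p}"
  let ?D = "distr M borel (\<lambda>x. (x, f x))"
  note D = graph_emeasure[OF M f G]
  have "\<exists>K. compact K \<and> K \<subseteq> ?\<Gamma> \<and> measure ?D K > 1 - 1 / Suc n" for n :: nat
    by (rule compact_inner_approx[OF D(1,2) graph_in_borel[OF f G(1)] D(3), of "1 - 1 / Suc n"]) auto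
  then have "\<forall>n::nat. \<exists>K. compact K \<and> K \<subseteq> ?\<Gamma> \<and> measure ?D K > 1 - 1 / Suc n" by blast
  from choice[OF this] obtain K where
    K: "\<And>n. compact (K n)" "\<And>n. K n \<subseteq> ?\<Gamma>" "\<And>n::nat. measure ?D (K n) > 1 - 1 / Suc n"
    by blast
  define U where "U = (\<Union>n. K n)"
  \<comment> \<open>Off the projection of \<open>U\<close> the value is arbitrary but constant, so a
    preimage contains all or nothing of that Borel complement.\<close>
  define g where "g y = (if y \<in> snd ` U then (THE x. (x, y) \<in> U) else undefined)" for y
  have uniq: "x = x'" if "(x, y) \<in> U" "(x', y) \<in> U" for x x' y
  proof -
    have *: "z \<in> - N \<and> f z = y" if zU: "(z, y) \<in> U" for z
    proof -
      obtain n where "(z, y) \<in> K n" using zU unfolding U_def by blast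
      from subsetD[OF K(2) this] show ?thesis by (simp add: G_def)
    qed
    show ?thesis using *[OF that(1)] *[OF that(2)] inj by (auto dest: inj_onD)
  qed
  have g: "g y = x" if "(x, y) \<in> U" for x y
  proof -
    have "(THE x. (x, y) \<in> U) = x" using that uniq by blast
    moreover have "y \<in> snd ` U" using that by force
    ultimately show ?thesis by (simp add: g_def)
  qed
  have bU: "snd ` U \<in> sets borel"
    unfolding U_def image_UN
    by (intro sets.countable_UN'') (auto intro!: borel_compact compact_continuous_image continuous_intros K)
  show ?thesis
  proof
    show "g \<in> borel_measurable borel"
      unfolding borel_eq_closed[where 'a='a]
    proof (rule measurable_measure_of)
      fix F :: "'a set" assume "F \<in> {F. closed F}"
      then have F: "closed F" by simp
      have "g -` F = (\<Union>n. snd ` (K n \<inter> F \<times> UNIV)) \<union> (if undefined \<in> F then - snd ` U else {})"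
      proof (intro set_eqI iffI)
        fix y assume "y \<in> g -` F"
        then have y: "g y \<in> F" by simp
        show "y \<in> (\<Union>n. snd ` (K n \<inter> F \<times> UNIV)) \<union> (if undefined \<in> F then - snd ` U else {})"
        proof (cases "y \<in> snd ` U")
          case True
          then obtain x where x: "(x, y) \<in> U" by force
          then obtain n where "(x, y) \<in> K n" by (auto simp: U_def)
          with y g[OF x] show ?thesis by force
        next
          case False with y show ?thesis by (simp add: g_def)
        qed
      next
        fix y assume y: "y \<in> (\<Union>n. snd ` (K n \<inter> F \<times> UNIV)) \<union> (if undefined \<in> F then - snd ` U else {})"
        then consider n x where "(x, y) \<in> K n" "x \<in> F" | "undefined \<in> F" "y \<notin> snd ` U"
          by (auto split: if_splits)
        then show "y \<in> g -` F"
        proof cases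
          case 1
          then have "(x, y) \<in> U" by (auto simp: U_def)
          from g[OF this] 1 show ?thesis by simp
        qed (simp add: g_def)
      qed
      also have "\<dots> \<in> sets borel"
        using bU by (intro sets.Un sets.countable_UN'')
          (auto intro!: borel_compact compact_continuous_image continuous_intros compact_Int_closed K closed_Times F)
      finally show "g -` F \<inter> space borel \<in> sets borel" by simp
    qed auto
    have bS: "U \<in> sets borel"
      unfolding U_def by (intro sets.countable_UN'') (auto intro: borel_compact K)
    have "measure ?D U = 1"
    proof (rule antisym)
      interpret D: prob_space ?D by (rule D(2))
      show "measure ?D U \<le> 1" by (rule D.prob_le_1)
      have "1 - 1 / Suc n \<le> measure ?D U" for n
      proof -
        have "measure ?D (K n) \<le> measure ?D U"
          using bS by (intro D.finite_measure_mono) (auto simp: U_def)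
        with K(3)[of n] show ?thesis by linarith
      qed
      moreover have "(\<lambda>n. 1 - 1 / real (Suc n)) \<longlonglongrightarrow> 1 - 0"
        by (intro tendsto_diff tendsto_const lim_1_over_n LIMSEQ_Suc)
      ultimately show "1 \<le> measure ?D U"
        by (intro LIMSEQ_le_const2[of _ 1]) auto
    qed
    then have "AE p in ?D. p \<in> U"
      by (intro prob_space.AE_prob_1[OF D(2)])
    moreover have "(\<lambda>x. (x, f x)) \<in> M \<rightarrow>\<^sub>M borel"
    proof -
      note [measurable_cong] = M(1) and [measurable] = f
      show ?thesis unfolding borel_prod[symmetric] by measurable
    qed
    ultimately have "AE x in M. (x, f x) \<in> U"
      by (rule AE_distrD[rotated])
    then show "AE x in M. g (f x) = x" by eventually_elim (rule g)
  qed
qed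

subsection \<open>Countable generators and sampling\<close>

text \<open>Countability lets the exceptional null sets of the law of large numbers be united over
  the generator, and stability under intersections lets the generator determine a finite measure.
  The intersection of the empty family supplies \<open>UNIV\<close>.\<close>

lemma ex_countable_Int_stable_generator:
  obtains E :: "'a::second_countable_topology set set"
  where "countable E" "Int_stable E" "UNIV \<in> E" "E \<subseteq> sets borel" "sets borel = sigma_sets UNIV E"
proof -
  obtain B :: "'a set set" where B: "countable B" "topological_basis B"
    using ex_countable_basis by blast
  define E where "E = Inter ` {F. finite F \<and> F \<subseteq> B}"
  have BE: "B \<subseteq> E" unfolding E_def by (rule subsetI, rule image_eqI[of _ _ "{_}"]) auto
  have op: "X \<in> sets borel" if "X \<in> E" for X
    using that B(2) unfolding E_def by (auto intro!: borel_open open_Inter simp: topological_basis_open subset_eq)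
  have "sets (borel :: 'a measure) = sigma_sets UNIV B"
    by (subst borel_eq_countable_basis[OF B]) simp
  moreover have "sigma_sets UNIV B \<subseteq> sigma_sets UNIV E" by (rule sigma_sets_mono') (rule BE)
  moreover have "sigma_sets UNIV E \<subseteq> sets borel"
    using op by (intro sets.sigma_sets_subset[of _ borel, simplified]) auto
  moreover have "Int_stable E"
  proof (rule Int_stableI)
    fix X Y assume "X \<in> E" "Y \<in> E"
    then obtain F G where "finite F" "F \<subseteq> B" "X = \<Inter>F" "finite G" "G \<subseteq> B" "Y = \<Inter>G"
      by (auto simp: E_def)
    then show "X \<inter> Y \<in> E" unfolding E_def by (intro image_eqI[of _ _ "F \<union> G"]) auto
  qed
  moreover have "countable E"
    unfolding E_def by (intro countable_image countable_Collect_finite_subset B)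
  moreover have "UNIV \<in> E" unfolding E_def by (rule image_eqI[of _ _ "{}"]) auto
  ultimately show thesis using op by (intro that[of E]) auto
qed

lemma borel_measure_eqI_Int_stable:
  assumes E: "Int_stable E" "UNIV \<in> E" "sets borel = sigma_sets UNIV E"
    and "sets M = sets borel" "sets N = sets borel" "emeasure M UNIV \<noteq> \<infinity>"
    and "\<And>B. B \<in> E \<Longrightarrow> emeasure M B = emeasure N B"
  shows "M = N"
  by (rule measure_eqI_generator_eq[OF E(1), of UNIV _ _ "\<lambda>_. UNIV"]) (use assms in auto)

text \<open>Adding \<open>C\<close> makes both functions nonnegative, so they become densities of
  finite measures; these agree on the generator, hence everywhere, and densities are unique almost
  everywhere.\<close>

lemma AE_eq_if_set_integrals_eq:
  fixes f g :: "'a::second_countable_topology \<Rightarrow> real"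
  assumes M: "sets M = sets borel" "prob_space M"
    and E: "Int_stable E" "UNIV \<in> E" "E \<subseteq> sets borel" "sets borel = sigma_sets UNIV E"
    and m: "f \<in> borel_measurable M" "g \<in> borel_measurable M"
    and bd: "\<And>x. \<bar>f x\<bar> \<le> C" "\<And>x. \<bar>g x\<bar> \<le> C"
    and eq: "\<And>B. B \<in> E \<Longrightarrow> (\<integral>x. f x * indicator B x \<partial>M) = (\<integral>x. g x * indicator B x \<partial>M)"
  shows "AE x in M. f x = g x"
proof -
  interpret prob_space M by fact
  note [measurable] = m
  have sM: "space M = UNIV" using sets_eq_imp_space_eq[OF M(1)] by simp
  have em: "emeasure (density M (\<lambda>x. ennreal (h x + C))) B = ennreal ((\<integral>x. h x * indicator B x \<partial>M) + C * measure M B)"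
    if [measurable]: "h \<in> borel_measurable M" and hb: "\<And>x. \<bar>h x\<bar> \<le> C" and B: "B \<in> sets borel" for h B
  proof -
    have BM[measurable]: "B \<in> sets M" using B M(1) by simp
    have i1: "integrable M (\<lambda>x. h x * indicator B x)"
      by (rule integrable_const_bound[of _ C]) (auto simp: indicator_def hb intro: order_trans[OF abs_ge_zero hb])
    have i2: "integrable M (\<lambda>x. C * indicator B x)"
      by (intro integrable_mult_right) (auto simp: emeasure_eq_measure)
    have "emeasure (density M (\<lambda>x. ennreal (h x + C))) B = (\<integral>\<^sup>+x. ennreal (h x * indicator B x + C * indicator B x) \<partial>M)"
      by (subst emeasure_density) (auto intro!: nn_integral_cong simp: indicator_def)
    also have "\<dots> = ennreal (\<integral>x. h x * indicator B x + C * indicator B x \<partial>M)"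
    proof (rule nn_integral_eq_integral)
      show "integrable M (\<lambda>x. h x * indicator B x + C * indicator B x)"
        by (intro Bochner_Integration.integrable_add i1 i2)
      show "AE x in M. 0 \<le> h x * indicator B x + C * indicator B x"
        using hb by (auto simp: indicator_def abs_le_iff intro!: AE_I2) (metis add.commute add_le_cancel_left add.right_inverse minus_le_iff)
    qed
    also have "(\<integral>x. h x * indicator B x + C * indicator B x \<partial>M) = (\<integral>x. h x * indicator B x \<partial>M) + C * measure M B"
      by (subst Bochner_Integration.integral_add[OF i1 i2]) (simp add: sM)
    finally show ?thesis .
  qed
  have "density M (\<lambda>x. ennreal (f x + C)) = density M (\<lambda>x. ennreal (g x + C))"
  proof (rule borel_measure_eqI_Int_stable[OF E(1,2,4)])
    show "emeasure (density M (\<lambda>x. ennreal (f x + C))) B = emeasure (density M (\<lambda>x. ennreal (g x + C))) B"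
      if "B \<in> E" for B using that E(3) eq[OF that] by (subst (1 2) em) (auto intro: bd)
  qed (auto simp: M(1) em[OF m(1) bd(1)])
  then have "AE x in M. ennreal (f x + C) = ennreal (g x + C)"
    by (subst (asm) density_unique_iff) auto
  then show ?thesis
  proof eventually_elim
    case (elim x)
    have "0 \<le> f x + C" "0 \<le> g x + C" using bd(1)[of x] bd(2)[of x] by auto
    with elim show ?case by simp
  qed
qed

lemma sets_Collect_tendsto:
  fixes L :: "'a \<Rightarrow> real"
  assumes [measurable]: "\<And>n. X n \<in> borel_measurable M" "L \<in> borel_measurable M"
  shows "{x \<in> space M. (\<lambda>n. X n x) \<longlonglongrightarrow> L x} \<in> sets M"
proof -
  have "(\<lambda>n. X n x) \<longlonglongrightarrow> L x \<longleftrightarrow> Cauchy (\<lambda>n. X n x) \<and> lim (\<lambda>n. X n x) = L x" for x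
    by (auto simp: limI Cauchy_convergent_iff convergent_LIMSEQ_iff dest: convergentI)
  then have "{x \<in> space M. (\<lambda>n. X n x) \<longlonglongrightarrow> L x}
     = {x \<in> space M. Cauchy (\<lambda>n. X n x)} \<inter> {x \<in> space M. lim (\<lambda>n. X n x) = L x}" by auto
  also have "\<dots> \<in> sets M"
    by (intro sets.Int) measurable
  finally show ?thesis .
qed

text \<open>The hypothesis speaks about one i.i.d. sequence, whereas the reconstruction needs a
  sequence \<open>u\<close> of reference points and an independent sequence \<open>p\<close> of
  pairs. Each block of three positions holds one reference point and the two members of one pair, so
  every index is used exactly once.\<close>

definition interleave :: "(nat \<Rightarrow> 'a) \<Rightarrow> (nat \<Rightarrow> 'a \<times> 'a) \<Rightarrow> nat \<Rightarrow> 'a" where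
  "interleave u p n = (if n mod 3 = 0 then u (n div 3)
     else if n mod 3 = 1 then fst (p (n div 3)) else snd (p (n div 3)))"

lemma interleave_simps [simp]:
  "interleave u p (3 * n) = u n" "interleave u p (Suc (3 * n)) = fst (p n)"
  "interleave u p (Suc (Suc (3 * n))) = snd (p n)"
proof -
  have "Suc (3 * n) mod 3 = 1" "Suc (3 * n) div 3 = n" "Suc (Suc (3 * n)) mod 3 = 2" "Suc (Suc (3 * n)) div 3 = n"
    by presburger+
  then show "interleave u p (3 * n) = u n" "interleave u p (Suc (3 * n)) = fst (p n)"
    "interleave u p (Suc (Suc (3 * n))) = snd (p n)"
    by (simp_all add: interleave_def)
qed

lemma all_less_mult_3: "(\<forall>j<n*3::nat. P j) \<longleftrightarrow> (\<forall>i<n. P (3*i) \<and> P (Suc (3*i)) \<and> P (Suc (Suc (3*i))))"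
proof (intro iffI allI impI)
  fix j assume *: "\<forall>i<n. P (3*i) \<and> P (Suc (3*i)) \<and> P (Suc (Suc (3*i)))" "j < n * 3"
  then have "j div 3 < n" by (simp add: less_mult_imp_div_less)
  moreover have "j = 3 * (j div 3) \<or> j = Suc (3 * (j div 3)) \<or> j = Suc (Suc (3 * (j div 3)))" by presburger
  ultimately show "P j" using *(1) by metis
qed auto

lemma measurable_interleave:
  "(\<lambda>x. interleave (fst x) (snd x)) \<in> PiM UNIV (\<lambda>_. M) \<Otimes>\<^sub>M PiM UNIV (\<lambda>_. M \<Otimes>\<^sub>M M) \<rightarrow>\<^sub>M PiM UNIV (\<lambda>_. M)"
  by (rule measurable_PiM_single') (auto simp: interleave_def space_PiM space_pair_measure PiE_iff mem_Times_iff)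

text \<open>It suffices to compare cylinders. Once the indices are padded to complete blocks of
  three, the preimage of a cylinder is a rectangle, whose mass is a product over blocks.\<close>

lemma distr_interleave:
  assumes "prob_space M"
  shows "distr (PiM (UNIV :: nat set) (\<lambda>_. M) \<Otimes>\<^sub>M PiM UNIV (\<lambda>_. M \<Otimes>\<^sub>M M)) (PiM UNIV (\<lambda>_. M)) (\<lambda>x. interleave (fst x) (snd x))
    = PiM UNIV (\<lambda>_. M)" (is "distr (?S \<Otimes>\<^sub>M ?S2) _ ?f = _")
proof -
  interpret M: prob_space M by fact
  interpret MM: pair_prob_space M M by unfold_locales
  interpret S: product_prob_space "\<lambda>_::nat. M" UNIV by unfold_locales
  interpret S2: product_prob_space "\<lambda>_::nat. M \<Otimes>\<^sub>M M" UNIV by unfold_locales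
  show ?thesis
  proof (rule S.PiM_eq)
    fix J :: "nat set" and F assume J: "finite J" and F0: "\<And>j. j \<in> J \<Longrightarrow> F j \<in> sets M"
    \<comment> \<open>Unconstrained positions are filled with the whole space, of mass 1, so that
      the cylinder can be described by all positions below \<open>n * 3\<close>.\<close>
    define G where "G j = (if j \<in> J then F j else space M)" for j
    have G: "G j \<in> sets M" for j using F0 by (auto simp: G_def)
    obtain n where n: "J \<subseteq> {..<n*3}"
    proof -
      obtain k where "J \<subseteq> {..<k}" using J by (metis finite_nat_bounded)
      then have "J \<subseteq> {..<k*3}" by fastforce
      with that show ?thesis by blast
    qed
    let ?E = "prod_emb UNIV (\<lambda>_. M) J (\<Pi>\<^sub>E j\<in>J. F j)"
    let ?A = "prod_emb UNIV (\<lambda>_. M) {..<n} (\<Pi>\<^sub>E i\<in>{..<n}. G (3*i))"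
    let ?B = "prod_emb UNIV (\<lambda>_. M \<Otimes>\<^sub>M M) {..<n} (\<Pi>\<^sub>E i\<in>{..<n}. G (Suc (3*i)) \<times> G (Suc (Suc (3*i))))"
    have mem: "w \<in> ?E \<longleftrightarrow> (\<forall>j<n*3. w j \<in> G j)" if "w \<in> space ?S" for w
      using n that by (auto simp: prod_emb_def space_PiM PiE_iff G_def Pi_iff)
    have "?f -` ?E \<inter> space (?S \<Otimes>\<^sub>M ?S2) = ?A \<times> ?B"
    proof (intro set_eqI)
      fix x :: "(nat \<Rightarrow> 'a) \<times> (nat \<Rightarrow> 'a \<times> 'a)"
      obtain u p where x: "x = (u, p)" by force
      show "x \<in> ?f -` ?E \<inter> space (?S \<Otimes>\<^sub>M ?S2) \<longleftrightarrow> x \<in> ?A \<times> ?B"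
      proof (cases "x \<in> space (?S \<Otimes>\<^sub>M ?S2)")
        case True
        then have "?f x \<in> space ?S" by (rule measurable_space[OF measurable_interleave])
        from mem[OF this] show ?thesis using True
          by (auto simp: x all_less_mult_3 prod_emb_def space_pair_measure space_PiM PiE_iff Pi_iff mem_Times_iff)
      next
        case False
        then show ?thesis
          by (auto simp: x prod_emb_def space_pair_measure space_PiM PiE_iff)
      qed
    qed
    then have "emeasure (distr (?S \<Otimes>\<^sub>M ?S2) ?S ?f) ?E = emeasure (?S \<Otimes>\<^sub>M ?S2) (?A \<times> ?B)"
      using J F0 by (subst emeasure_distr[OF measurable_interleave]) (auto intro!: sets_PiM_I)
    also have "\<dots> = emeasure ?S ?A * emeasure ?S2 ?B"
      using G by (intro S2.emeasure_pair_measure_Times sets_PiM_I) auto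
    also have "emeasure ?S ?A = (\<Prod>i<n. emeasure M (G (3*i)))"
      using G by (intro S.emeasure_PiM_emb) auto
    also have "emeasure ?S2 ?B = (\<Prod>i<n. emeasure (M \<Otimes>\<^sub>M M) (G (Suc (3*i)) \<times> G (Suc (Suc (3*i)))))"
      using G by (intro S2.emeasure_PiM_emb) auto
    also have "\<dots> = (\<Prod>i<n. emeasure M (G (Suc (3*i))) * emeasure M (G (Suc (Suc (3*i)))))"
      using G by (intro prod.cong refl M.emeasure_pair_measure_Times) auto
    also have "(\<Prod>i<n. emeasure M (G (3*i))) * \<dots>
        = (\<Prod>i<n. prod (\<lambda>j. emeasure M (G j)) {i*3..<i*3+3})"
      by (subst prod.distrib[symmetric]) (auto intro!: prod.cong simp: numeral_3_eq_3 mult_ac)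
    also have "\<dots> = (\<Prod>j<n*3. emeasure M (G j))"
      by (rule prod.nat_group)
    also have "\<dots> = (\<Prod>j\<in>J. emeasure M (G j))"
      using n by (intro prod.mono_neutral_right) (auto simp: G_def M.emeasure_space_1)
    also have "\<dots> = (\<Prod>j\<in>J. emeasure M (F j))" by (intro prod.cong) (auto simp: G_def)
    finally show "emeasure (distr (?S \<Otimes>\<^sub>M ?S2) ?S ?f) ?E = (\<Prod>j\<in>J. emeasure M (F j))" .
  qed simp
qed

subsection \<open>Reconstruction from sampled arrays\<close>

text \<open>Diagonal kernel values are set to 0: kernels are preserved only almost everywhere with respect
  to the product measure, so their values on the diagonal carry no invariant information.\<close>

definition sample_array :: "('i \<Rightarrow> 'o \<Rightarrow> real) \<Rightarrow> ('j \<Rightarrow> 'o \<Rightarrow> 'o \<Rightarrow> real) \<Rightarrow> (nat \<Rightarrow> 'o)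
    \<Rightarrow> nat \<times> 'i + nat \<times> nat \<times> 'j \<Rightarrow> real" where
  "sample_array mk kn w = case_sum (\<lambda>(i, \<alpha>). mk \<alpha> (w i))
     (\<lambda>(i, j, c). if i = j then 0 else kn c (w i) (w j))"

text \<open>The flag records whether \<open>z\<close> is the first or the second argument: kernels
  need not be symmetric, and being twins compares rows as well as columns.\<close>

definition profile :: "('i \<Rightarrow> 'o \<Rightarrow> real) \<Rightarrow> ('j \<Rightarrow> 'o \<Rightarrow> 'o \<Rightarrow> real) \<Rightarrow> (nat \<Rightarrow> 'o) \<Rightarrow> 'o
    \<Rightarrow> 'i + bool \<times> nat \<times> 'j \<Rightarrow> real" where
  "profile mk kn u z = case_sum (\<lambda>\<alpha>. mk \<alpha> z) (\<lambda>(b, i, c). if b then kn c z (u i) else kn c (u i) z)"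

text \<open>The kernel value between the two points is a coordinate of neither profile; keeping it
  alongside makes the joint law remember how the kernel depends on the two profiles.\<close>

definition pair_profile :: "('i \<Rightarrow> 'o \<Rightarrow> real) \<Rightarrow> ('j \<Rightarrow> 'o \<Rightarrow> 'o \<Rightarrow> real) \<Rightarrow> (nat \<Rightarrow> 'o) \<Rightarrow> 'o \<times> 'o
    \<Rightarrow> ('i + bool \<times> nat \<times> 'j \<Rightarrow> real) \<times> ('i + bool \<times> nat \<times> 'j \<Rightarrow> real) \<times> ('j \<Rightarrow> real)" where
  "pair_profile mk kn u p = (profile mk kn u (fst p), profile mk kn u (snd p), \<lambda>c. kn c (fst p) (snd p))"

lemma borel_measurable_funI:
  fixes f :: "'a \<Rightarrow> 'i::countable \<Rightarrow> 'b::second_countable_topology"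
  assumes "\<And>i. (\<lambda>x. f x i) \<in> borel_measurable M"
  shows "f \<in> borel_measurable M"
  using assms by (rule measurable_coordinatewise_then_product)

text \<open>The carrier has no topology here, so that the locale also covers joinings, whose type is
  only of class \<open>metric_space\<close>; \<open>borel_mck_space\<close> adds the Polish
  structure.\<close>

locale mck_prob_space = prob_space \<rho> for \<rho> :: "'o measure" +
  fixes mk :: "'i::countable \<Rightarrow> 'o \<Rightarrow> real" and kn :: "'j::countable \<Rightarrow> 'o \<Rightarrow> 'o \<Rightarrow> real"
  assumes mck: "mck_space \<rho> mk kn"
begin

lemma mk_measurable [measurable]: "mk \<alpha> \<in> borel_measurable \<rho>"
  using mck by (simp add: mck_space_def)

lemma kn_measurable' [measurable]: "(\<lambda>p. kn c (fst p) (snd p)) \<in> borel_measurable (\<rho> \<Otimes>\<^sub>M \<rho>)"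
  using mck by (simp add: mck_space_def)

lemma kn_measurable [measurable (raw)]:
  assumes "f \<in> M \<rightarrow>\<^sub>M \<rho>" "g \<in> M \<rightarrow>\<^sub>M \<rho>"
  shows "(\<lambda>x. kn c (f x) (g x)) \<in> borel_measurable M"
  using measurable_compose[OF measurable_Pair[OF assms] kn_measurable'] by simp

lemma sample_array_measurable [measurable (raw)]:
  assumes [measurable]: "w \<in> M \<rightarrow>\<^sub>M PiM (UNIV :: nat set) (\<lambda>_. \<rho>)"
  shows "(\<lambda>x. sample_array mk kn (w x)) \<in> borel_measurable M"
proof (rule borel_measurable_funI)
  fix e :: "nat \<times> 'i + nat \<times> nat \<times> 'j"
  have [measurable]: "(\<lambda>x. w x i) \<in> M \<rightarrow>\<^sub>M \<rho>" for i
    by (rule measurable_compose[OF assms(1) measurable_component_singleton]) simp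
  show "(\<lambda>x. sample_array mk kn (w x) e) \<in> borel_measurable M"
    by (cases e) (auto simp: sample_array_def split: prod.splits)
qed

end

locale borel_mck_space = mck_prob_space \<rho> mk kn
  for \<rho> :: "'o::polish_space measure" and mk :: "'i::countable \<Rightarrow> 'o \<Rightarrow> real"
    and kn :: "'j::countable \<Rightarrow> 'o \<Rightarrow> 'o \<Rightarrow> real" +
  assumes sets_eq: "sets \<rho> = sets borel"
begin

abbreviation "\<rho>2 \<equiv> \<rho> \<Otimes>\<^sub>M \<rho>"
abbreviation "S \<equiv> PiM (UNIV :: nat set) (\<lambda>_. \<rho>)"
abbreviation "S2 \<equiv> PiM (UNIV :: nat set) (\<lambda>_. \<rho>2)"

lemma space_eq [simp]: "space \<rho> = UNIV"
  using sets_eq_imp_space_eq[OF sets_eq] by simp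

lemma sets_\<rho>2: "sets \<rho>2 = sets borel"
  by (subst sets_pair_measure_cong[OF sets_eq sets_eq]) (simp only: borel_prod)

lemma sets_S: "sets S = sets borel"
  by (subst sets_PiM_cong[OF refl sets_eq]) (rule sets_PiM_equal_borel)

lemma sets_S2: "sets S2 = sets borel"
  by (subst sets_PiM_cong[OF refl sets_\<rho>2]) (rule sets_PiM_equal_borel)

sublocale pair: pair_prob_space \<rho> \<rho> ..
sublocale S: product_prob_space "\<lambda>_. \<rho>" "UNIV :: nat set" ..
sublocale S2: product_prob_space "\<lambda>_. \<rho>2" "UNIV :: nat set" ..
sublocale Q: pair_prob_space S S2 ..
sublocale S\<rho>: pair_prob_space S \<rho> ..

lemma kn_bounded: "\<exists>B. \<forall>x y. \<bar>kn c x y\<bar> \<le> B"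
proof -
  have "bounded ((\<lambda>p. kn c (fst p) (snd p)) ` UNIV)"
    using mck by (simp add: mck_space_def space_pair_measure)
  then obtain B where "\<And>p. \<bar>kn c (fst p) (snd p)\<bar> \<le> B" by (auto simp: bounded_iff)
  then have "\<bar>kn c x y\<bar> \<le> B" for x y by (metis fst_conv snd_conv)
  then show ?thesis by blast
qed

lemma profile_measurable [measurable (raw)]:
  assumes [measurable]: "u \<in> M \<rightarrow>\<^sub>M S" "z \<in> M \<rightarrow>\<^sub>M \<rho>"
  shows "(\<lambda>x. profile mk kn (u x) (z x)) \<in> borel_measurable M"
proof (rule borel_measurable_funI)
  fix e :: "'i + bool \<times> nat \<times> 'j"
  have [measurable]: "(\<lambda>x. u x i) \<in> M \<rightarrow>\<^sub>M \<rho>" for i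
    by (rule measurable_compose[OF assms(1) measurable_component_singleton]) simp
  show "(\<lambda>x. profile mk kn (u x) (z x) e) \<in> borel_measurable M"
    by (cases e) (auto simp: profile_def split: prod.splits)
qed

lemma pair_profile_measurable [measurable (raw)]:
  assumes [measurable]: "u \<in> M \<rightarrow>\<^sub>M S" "p \<in> M \<rightarrow>\<^sub>M \<rho>2"
  shows "(\<lambda>x. pair_profile mk kn (u x) (p x)) \<in> borel_measurable M"
proof -
  have [measurable]: "(\<lambda>x. (\<lambda>c. kn c (fst (p x)) (snd (p x)))) \<in> borel_measurable M"
    by (rule borel_measurable_funI) measurable
  show ?thesis unfolding pair_profile_def borel_prod[symmetric] by measurable
qed

text \<open>For fixed \<open>z\<close>, averages of kernel values against \<open>u i\<close>
  weighted by \<open>indicator B (u i)\<close> recover the integral of a row or column of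
  \<open>z\<close> over \<open>B\<close>, and the weights do not depend on \<open>z\<close>. Equal
  profiles therefore give equal integrals over every \<open>B\<close> in a generator, hence equal
  rows and columns almost everywhere.\<close>

lemma AE_sample_separates:
  "AE u in S. \<exists>N\<in>null_sets \<rho>. \<forall>z\<in>-N. \<forall>z'\<in>-N.
     profile mk kn u z = profile mk kn u z' \<longrightarrow> twins \<rho> mk kn z z'"
proof -
  obtain E :: "'o set set" where E: "countable E" "Int_stable E" "UNIV \<in> E" "E \<subseteq> sets borel"
    "sets borel = sigma_sets UNIV E"
    by (rule ex_countable_Int_stable_generator)
  \<comment> \<open>Merging rows and columns into \<open>k\<close> treats both halves of the twin
    condition at once.\<close>
  define k where "k b c z w = (if b then kn c z w else kn c w z)" for b c z w
  have k[measurable]: "(\<lambda>x. k b c (f x) (g x)) \<in> borel_measurable M"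
    if "f \<in> M \<rightarrow>\<^sub>M \<rho>" "g \<in> M \<rightarrow>\<^sub>M \<rho>" for M and b c and f g :: "'e \<Rightarrow> 'o"
    using kn_measurable[OF that] kn_measurable[OF that(2,1)] by (cases b) (auto simp: k_def)
  have lim: "AE u in S. AE z in \<rho>. (\<lambda>n. (\<Sum>i<n. k b c z (u i) * indicator B (u i)) / real n)
      \<longlonglongrightarrow> (\<integral>w. k b c z w * indicator B w \<partial>\<rho>)" if B: "B \<in> E" for b c B
  proof -
    have [measurable]: "B \<in> sets \<rho>" using B E(4) sets_eq by auto
    have [measurable]: "(\<lambda>x. fst x i) \<in> S \<Otimes>\<^sub>M \<rho> \<rightarrow>\<^sub>M \<rho>" for i
      by (rule measurable_compose[OF measurable_fst measurable_component_singleton]) simp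
    have "AE z in \<rho>. AE u in S. (\<lambda>n. (\<Sum>i<n. k b c z (u i) * indicator B (u i)) / real n)
      \<longlonglongrightarrow> (\<integral>w. k b c z w * indicator B w \<partial>\<rho>)"
    proof (rule AE_I2)
      fix z
      obtain C where C: "\<And>x y. \<bar>kn c x y\<bar> \<le> C" using kn_bounded by blast
      have "C \<ge> 0" using C[of z z] by linarith
      then show "AE u in S. (\<lambda>n. (\<Sum>i<n. k b c z (u i) * indicator B (u i)) / real n)
        \<longlonglongrightarrow> (\<integral>w. k b c z w * indicator B w \<partial>\<rho>)"
        by (intro bounded_slln[where B=C]) (auto simp: k_def C indicator_def prob_space_axioms)
    qed
    moreover have "{x \<in> space (S \<Otimes>\<^sub>M \<rho>). (\<lambda>n. (\<Sum>i<n. k b c (snd x) (fst x i) * indicator B (fst x i)) / real n)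
      \<longlonglongrightarrow> (\<integral>w. k b c (snd x) w * indicator B w \<partial>\<rho>)} \<in> sets (S \<Otimes>\<^sub>M \<rho>)"
      by (intro sets_Collect_tendsto) measurable
    \<comment> \<open>The law of large numbers holds for every \<open>z\<close> and almost every
      \<open>u\<close>; Fubini turns this into almost every \<open>u\<close> serving almost every
      \<open>z\<close>, which is where the null set depending on \<open>u\<close> comes
      from.\<close>
    ultimately show ?thesis by (subst S\<rho>.AE_commute) auto
  qed
  have "AE u in S. \<forall>b c. \<forall>B\<in>E. AE z in \<rho>. (\<lambda>n. (\<Sum>i<n. k b c z (u i) * indicator B (u i)) / real n)
      \<longlonglongrightarrow> (\<integral>w. k b c z w * indicator B w \<partial>\<rho>)"
    unfolding AE_all_countable AE_ball_countable[OF E(1)] using lim by blast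
  then show ?thesis
  proof eventually_elim
    case (elim u)
    then have "AE z in \<rho>. \<forall>b c. \<forall>B\<in>E. (\<lambda>n. (\<Sum>i<n. k b c z (u i) * indicator B (u i)) / real n)
      \<longlonglongrightarrow> (\<integral>w. k b c z w * indicator B w \<partial>\<rho>)"
      unfolding AE_all_countable AE_ball_countable[OF E(1)] by blast
    then obtain N where N: "N \<in> null_sets \<rho>" "\<And>z b c B. z \<notin> N \<Longrightarrow> B \<in> E \<Longrightarrow> 
      (\<lambda>n. (\<Sum>i<n. k b c z (u i) * indicator B (u i)) / real n) \<longlonglongrightarrow> (\<integral>w. k b c z w * indicator B w \<partial>\<rho>)"
      unfolding eventually_ae_filter space_eq by blast
    show ?case
    proof (intro bexI[OF _ N(1)] ballI impI)
      fix z z' assume z: "z \<in> -N" "z' \<in> -N" and eq: "profile mk kn u z = profile mk kn u z'"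
      have eqk: "k b c z (u i) = k b c z' (u i)" for b c i
        using fun_cong[OF eq, of "Inr (b, i, c)"] by (simp add: profile_def k_def)
      have ae: "AE w in \<rho>. k b c z w = k b c z' w" for b c
      proof -
        obtain C where C: "\<And>x y. \<bar>kn c x y\<bar> \<le> C" using kn_bounded by blast
        show ?thesis
        proof (rule AE_eq_if_set_integrals_eq[OF sets_eq prob_space_axioms E(2-5)])
          show "\<bar>k b c z w\<bar> \<le> C" "\<bar>k b c z' w\<bar> \<le> C" for w using C by (auto simp: k_def)
          show "(\<integral>w. k b c z w * indicator B w \<partial>\<rho>) = (\<integral>w. k b c z' w * indicator B w \<partial>\<rho>)" if "B \<in> E" for B
            using N(2)[of z B b c] N(2)[of z' B b c] z that unfolding eqk
            by (intro LIMSEQ_unique) auto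
        qed auto
      qed
      show "twins \<rho> mk kn z z'"
        unfolding twins_def
      proof (intro conjI allI)
        show "mk \<alpha> z = mk \<alpha> z'" for \<alpha>
          using fun_cong[OF eq, of "Inl \<alpha>"] by (simp add: profile_def)
        show "AE w in \<rho>. kn c z w = kn c z' w" for c using ae[of True c] by (simp add: k_def)
        show "AE w in \<rho>. kn c w z = kn c w z'" for c using ae[of False c] by (simp add: k_def)
      qed
    qed
  qed
qed

text \<open>For fixed reference points the profiles of i.i.d. pairs are i.i.d., so their frequencies
  converge on each set of the countable family. The frequencies depend on the array only, so a
  matched array carries the limit law with it.\<close>

lemma AE_pair_sample_law:
  assumes E: "countable E" "E \<subseteq> sets borel"
  shows "AE x in S \<Otimes>\<^sub>M S2. \<forall>B\<in>E. (\<lambda>n. (\<Sum>i<n. indicator B (pair_profile mk kn (fst x) (snd x i))) / real n)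
     \<longlonglongrightarrow> measure (distr \<rho>2 borel (pair_profile mk kn (fst x))) B"
  unfolding AE_ball_countable[OF E(1)]
proof (rule ballI)
  fix B assume "B \<in> E"
  then have [measurable]: "B \<in> sets borel" using E by auto
  have pm[measurable]: "pair_profile mk kn u \<in> borel_measurable \<rho>2" if "u \<in> space S" for u
    by (rule pair_profile_measurable[where u="\<lambda>_. u"]) (auto simp: that)
  have meas: "measure (distr \<rho>2 borel (pair_profile mk kn u)) B
      = (\<integral>q. indicator B (pair_profile mk kn u q) \<partial>\<rho>2)" if [measurable]: "u \<in> space S" for u
  proof -
    have "(\<integral>y. (indicator B y :: real) \<partial>distr \<rho>2 borel (pair_profile mk kn u)) = (\<integral>q. indicator B (pair_profile mk kn u q) \<partial>\<rho>2)"
      by (rule integral_distr[OF pm[OF that]]) simp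
    then show ?thesis by simp
  qed
  have [measurable]: "(\<lambda>x. snd x i) \<in> S \<Otimes>\<^sub>M S2 \<rightarrow>\<^sub>M \<rho>2" for i
    by (rule measurable_compose[OF measurable_snd measurable_component_singleton]) simp
  have "AE x in S \<Otimes>\<^sub>M S2. (\<lambda>n. (\<Sum>i<n. indicator B (pair_profile mk kn (fst x) (snd x i))) / real n)
     \<longlonglongrightarrow> (\<integral>q. indicator B (pair_profile mk kn (fst x) q) \<partial>\<rho>2)"
  proof (rule Q.AE_pair_measure)
    show "{x \<in> space (S \<Otimes>\<^sub>M S2). (\<lambda>n. (\<Sum>i<n. indicator B (pair_profile mk kn (fst x) (snd x i)) :: real) / real n)
       \<longlonglongrightarrow> (\<integral>q. indicator B (pair_profile mk kn (fst x) q) \<partial>\<rho>2)} \<in> sets (S \<Otimes>\<^sub>M S2)"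
      by (intro sets_Collect_tendsto) measurable
    show "AE u in S. AE p in S2. (\<lambda>n. (\<Sum>i<n. indicator B (pair_profile mk kn (fst (u, p)) (snd (u, p) i)) :: real) / real n)
       \<longlonglongrightarrow> (\<integral>q. indicator B (pair_profile mk kn (fst (u, p)) q) \<partial>\<rho>2)"
    proof (rule AE_I2)
      fix u assume [measurable]: "u \<in> space S"
      show "AE p in S2. (\<lambda>n. (\<Sum>i<n. indicator B (pair_profile mk kn (fst (u, p)) (snd (u, p) i)) :: real) / real n)
       \<longlonglongrightarrow> (\<integral>q. indicator B (pair_profile mk kn (fst (u, p)) q) \<partial>\<rho>2)"
        unfolding fst_conv snd_conv
        by (rule bounded_slln[where B=1]) (auto simp: indicator_def pair.prob_space_axioms)
    qed
  qed
  then show "AE x in S \<Otimes>\<^sub>M S2. (\<lambda>n. (\<Sum>i<n. indicator B (pair_profile mk kn (fst x) (snd x i))) / real n)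
     \<longlonglongrightarrow> measure (distr \<rho>2 borel (pair_profile mk kn (fst x))) B"
    by (rule AE_mp) (auto intro!: AE_I2 simp: meas space_pair_measure)
qed

end

lemma AE_pair_fst:
  assumes "prob_space M" "prob_space N" "AE x in M. P x"
  shows "AE p in M \<Otimes>\<^sub>M N. P (fst p)"
proof -
  have "AE x in distr (M \<Otimes>\<^sub>M N) M fst. P x"
    using assms(3) unfolding prob_space.distr_pair_fst[OF assms(2)] .
  then show ?thesis by (rule AE_distrD[OF measurable_fst])
qed

lemma AE_pair_snd:
  assumes "prob_space M" "prob_space N" "AE x in N. P x"
  shows "AE p in M \<Otimes>\<^sub>M N. P (snd p)"
proof -
  interpret M: prob_space M by fact
  interpret N: prob_space N by fact
  obtain Z where Z: "Z \<in> null_sets N" "{x \<in> space N. \<not> P x} \<subseteq> Z"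
    using assms(3) unfolding eventually_ae_filter by blast
  have "emeasure (M \<Otimes>\<^sub>M N) (space M \<times> Z) = 0"
    using Z(1) by (subst N.emeasure_pair_measure_Times) (auto simp: null_sets_def)
  then have "space M \<times> Z \<in> null_sets (M \<Otimes>\<^sub>M N)"
    using Z(1) by (auto simp: null_sets_def)
  then show ?thesis
    by (rule AE_I') (use Z(2) in \<open>auto simp: space_pair_measure\<close>)
qed

context borel_mck_space begin

text \<open>Purity upgrades separation of non-twins to injectivity once its own null set
  \<open>N0\<close> is discarded. Measurability of the set of good samples is not claimed; they
  enter \<open>matching_points\<close> as an almost sure property. Membership in
  \<open>space S\<close> is recorded because it makes the profile maps of the chosen sample
  measurable.\<close>

lemma AE_good_sample:
  assumes pure: "rcm_pure \<rho> mk kn" and E: "countable E" "E \<subseteq> sets borel"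
  shows "AE x in S \<Otimes>\<^sub>M S2. (\<exists>N\<in>null_sets \<rho>. inj_on (profile mk kn (fst x)) (- N)) \<and> fst x \<in> space S \<and>
    (\<forall>B\<in>E. (\<lambda>n. (\<Sum>i<n. indicator B (pair_profile mk kn (fst x) (snd x i))) / real n)
     \<longlonglongrightarrow> measure (distr \<rho>2 borel (pair_profile mk kn (fst x))) B)"
proof -
  obtain N0 where N0: "N0 \<in> null_sets \<rho>" "\<And>z z'. z \<notin> N0 \<Longrightarrow> z' \<notin> N0 \<Longrightarrow> twins \<rho> mk kn z z' \<Longrightarrow> z = z'"
    using pure by (auto simp: rcm_pure_def)
  have "AE u in S. \<exists>N\<in>null_sets \<rho>. inj_on (profile mk kn u) (- N)"
    using AE_sample_separates
  proof eventually_elim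
    case (elim u)
    then obtain N where N: "N \<in> null_sets \<rho>" "\<And>z z'. z \<in> - N \<Longrightarrow> z' \<in> - N \<Longrightarrow>
      profile mk kn u z = profile mk kn u z' \<Longrightarrow> twins \<rho> mk kn z z'" by blast
    show ?case
    proof (rule bexI)
      show "inj_on (profile mk kn u) (- (N \<union> N0))"
        using N(2) N0(2) by (intro inj_onI) simp
    qed (intro null_sets.Un N N0)
  qed
  then have "AE x in S \<Otimes>\<^sub>M S2. \<exists>N\<in>null_sets \<rho>. inj_on (profile mk kn (fst x)) (- N)"
    by (rule AE_pair_fst[OF S.prob_space_axioms S2.prob_space_axioms])
  with AE_pair_sample_law[OF E] AE_space show ?thesis
    by eventually_elim (auto simp: space_pair_measure)
qed

lemma distr_sample_array_interleave:
  "distr (S \<Otimes>\<^sub>M S2) borel (\<lambda>x. sample_array mk kn (interleave (fst x) (snd x)))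
     = distr S borel (sample_array mk kn)"
proof -
  have "distr S borel (sample_array mk kn)
      = distr (distr (S \<Otimes>\<^sub>M S2) S (\<lambda>x. interleave (fst x) (snd x))) borel (sample_array mk kn)"
    using distr_interleave[OF prob_space_axioms] by simp
  also have "\<dots> = distr (S \<Otimes>\<^sub>M S2) borel (\<lambda>x. sample_array mk kn (interleave (fst x) (snd x)))"
    by (subst distr_distr[OF _ measurable_interleave]) (auto simp: comp_def)
  finally show ?thesis by simp
qed

lemma sample_array_interleave_measurable:
  "(\<lambda>x. sample_array mk kn (interleave (fst x) (snd x))) \<in> borel_measurable borel"
proof -
  have "sets (S \<Otimes>\<^sub>M S2) = sets borel"
    by (subst sets_pair_measure_cong[OF sets_S sets_S2]) (simp only: borel_prod)
  moreover have "(\<lambda>x. sample_array mk kn (interleave (fst x) (snd x))) \<in> borel_measurable (S \<Otimes>\<^sub>M S2)"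
    by (rule sample_array_measurable) (rule measurable_interleave)
  ultimately show ?thesis using measurable_cong_sets by blast
qed

end

text \<open>The positions \<open>3 * j\<close> of the reference points and
  \<open>Suc (3 * i)\<close>, \<open>Suc (Suc (3 * i))\<close> of a pair are distinct, so every
  kernel value in a pair profile is an off-diagonal entry and escapes the zeros on the
  diagonal.\<close>

lemma sample_array_eq_imp_pair_profile_eq:
  assumes eq: "sample_array mk kn (interleave u p) = sample_array mk' kn' (interleave u' p')"
  shows "pair_profile mk kn u (p i) = pair_profile mk' kn' u' (p' i)"
proof -
  have mk: "mk \<alpha> (interleave u p j) = mk' \<alpha> (interleave u' p' j)" for \<alpha> j
    using fun_cong[OF eq, of "Inl (j, \<alpha>)"] by (simp add: sample_array_def)
  have kn: "kn c (interleave u p j) (interleave u p l) = kn' c (interleave u' p' j) (interleave u' p' l)"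
    if "j \<noteq> l" for c j l
    using fun_cong[OF eq, of "Inr (j, l, c)"] that by (simp add: sample_array_def)
  have ne: "Suc (3 * i) \<noteq> 3 * j" "3 * j \<noteq> Suc (3 * i)" "Suc (Suc (3 * i)) \<noteq> 3 * j" "3 * j \<noteq> Suc (Suc (3 * i))"
    "Suc (3 * i) \<noteq> Suc (Suc (3 * i))" for j
    by presburger+
  have "profile mk kn u (fst (p i)) = profile mk' kn' u' (fst (p' i))"
    using mk[of _ "Suc (3 * i)"] kn[OF ne(1)] kn[OF ne(2)]
    by (auto simp: profile_def fun_eq_iff split: sum.splits)
  moreover have "profile mk kn u (snd (p i)) = profile mk' kn' u' (snd (p' i))"
    using mk[of _ "Suc (Suc (3 * i))"] kn[OF ne(3)] kn[OF ne(4)]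
    by (auto simp: profile_def fun_eq_iff split: sum.splits)
  moreover have "kn c (fst (p i)) (snd (p i)) = kn' c (fst (p' i)) (snd (p' i))" for c
    using kn[OF ne(5)] by simp
  ultimately show ?thesis by (simp add: pair_profile_def)
qed

section \<open>From equal pair laws to a kernel isomorphism\<close>

lemma distr_fst_factor:
  fixes L :: "'x \<Rightarrow> 'y::second_countable_topology" and P :: "'x \<times> 'x \<Rightarrow> 'y \<times> 'z::second_countable_topology"
  assumes "prob_space M" and L: "L \<in> borel_measurable M" and P: "P \<in> borel_measurable (M \<Otimes>\<^sub>M M)"
    and eq: "\<And>p. fst (P p) = L (fst p)"
  shows "distr M borel L = distr (distr (M \<Otimes>\<^sub>M M) borel P) borel fst"
proof -
  have "distr M borel L = distr (distr (M \<Otimes>\<^sub>M M) M fst) borel L"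
    using assms(1) by (simp add: prob_space.distr_pair_fst)
  also have "\<dots> = distr (M \<Otimes>\<^sub>M M) borel (\<lambda>p. fst (P p))"
    by (subst distr_distr[OF L measurable_fst]) (simp add: comp_def eq)
  also have "\<dots> = distr (distr (M \<Otimes>\<^sub>M M) borel P) borel fst"
    by (subst distr_distr[OF _ P]) (auto simp: comp_def borel_prod[symmetric])
  finally show ?thesis .
qed

text \<open>The set where \<open>L' (W' x) = x\<close> is Borel and has full measure for the law of
  \<open>L'\<close>, which is also the law of \<open>L\<close>. In this way values of
  \<open>L\<close> almost surely lie in the range of \<open>L'\<close>, without any claim that this
  range is measurable.\<close>

lemma AE_right_inverse:
  fixes L :: "'x \<Rightarrow> 'z::polish_space"
  assumes L: "L \<in> borel_measurable M" and L': "L' \<in> borel_measurable M'" and W': "W' \<in> borel \<rightarrow>\<^sub>M M'"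
    and eq: "distr M borel L = distr M' borel L'" and ae: "AE z in M'. W' (L' z) = z"
  shows "AE z in M. L' (W' (L z)) = L z"
proof -
  have [measurable]: "(\<lambda>x. L' (W' x)) \<in> borel_measurable borel"
    using measurable_compose[OF W' L'] .
  have s: "{x \<in> space borel. L' (W' x) = x} \<in> sets borel"
  proof -
    have "{x \<in> space borel. L' (W' x) = x} = {x \<in> space borel. dist (L' (W' x)) x = 0}" by auto
    also have "\<dots> \<in> sets borel" by measurable
    finally show ?thesis .
  qed
  have "AE z in M'. L' (W' (L' z)) = L' z" using ae by eventually_elim simp
  then have "AE x in distr M' borel L'. L' (W' x) = x" by (subst AE_distr_iff[OF L' s])
  then show ?thesis unfolding eq[symmetric] by (subst (asm) AE_distr_iff[OF L s])
qed

lemma distr_via_inverse: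
  assumes L: "L \<in> borel_measurable M" and L': "L' \<in> borel_measurable M'" and W': "W' \<in> borel \<rightarrow>\<^sub>M M'"
    and eq: "distr M borel L = distr M' borel L'" and ae: "AE z in M'. W' (L' z) = z"
  shows "distr M M' (\<lambda>z. W' (L z)) = M'"
proof -
  have "distr M M' (\<lambda>z. W' (L z)) = distr (distr M borel L) M' W'"
    by (subst distr_distr[OF W' L]) (simp add: comp_def)
  also have "\<dots> = distr M' M' (\<lambda>z. W' (L' z))"
    unfolding eq by (subst distr_distr[OF W' L']) (simp add: comp_def)
  also have "\<dots> = distr M' M' (\<lambda>z. z)"
    using measurable_compose[OF L' W'] by (intro distr_cong_AE ae) auto
  finally show ?thesis by (simp add: distr_id)
qed

lemma AE_pair_map:
  assumes N: "prob_space N" and f: "f \<in> M \<rightarrow>\<^sub>M N" "distr M N f = N"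
    and P: "AE p in N \<Otimes>\<^sub>M N. P (fst p) (snd p)"
  shows "AE p in M \<Otimes>\<^sub>M M. P (f (fst p)) (f (snd p))"
proof -
  interpret N: prob_space N by fact
  have d: "distr (M \<Otimes>\<^sub>M M) (N \<Otimes>\<^sub>M N) (\<lambda>(x, y). (f x, f y)) = N \<Otimes>\<^sub>M N"
    using pair_measure_distr[OF f(1) f(1), unfolded f(2), OF N.sigma_finite_measure_axioms] by (rule sym)
  have m: "(\<lambda>(x, y). (f x, f y)) \<in> M \<Otimes>\<^sub>M M \<rightarrow>\<^sub>M N \<Otimes>\<^sub>M N"
    using f(1) by measurable
  have "AE p in distr (M \<Otimes>\<^sub>M M) (N \<Otimes>\<^sub>M N) (\<lambda>(x, y). (f x, f y)). P (fst p) (snd p)"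
    using P unfolding d .
  from AE_distrD[OF m this] show ?thesis by (simp add: case_prod_beta)
qed

lemma AE_pair_both:
  assumes "prob_space M" "AE z in M. P z"
  shows "AE p in M \<Otimes>\<^sub>M M. P (fst p) \<and> P (snd p)"
  using AE_pair_fst[OF assms(1,1,2)] AE_pair_snd[OF assms(1,1,2)] by eventually_elim simp

text \<open>The first marginal of the pair law is the law of a single profile, which yields the
  measure isomorphism and the marks; the third component pins down the kernels.\<close>

lemma kernel_iso_if_pair_profile_law_eq:
  fixes \<rho> :: "'o::polish_space measure" and mk :: "'a::countable \<Rightarrow> 'o \<Rightarrow> real" and kn :: "'b::countable \<Rightarrow> 'o \<Rightarrow> 'o \<Rightarrow> real"
    and \<rho>' :: "'p::polish_space measure" and mk' :: "'a \<Rightarrow> 'p \<Rightarrow> real" and kn' :: "'b \<Rightarrow> 'p \<Rightarrow> 'p \<Rightarrow> real"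
  assumes X: "borel_mck_space \<rho> mk kn" and Y: "borel_mck_space \<rho>' mk' kn'"
    and u: "u \<in> space (PiM UNIV (\<lambda>_. \<rho>))" and u': "u' \<in> space (PiM UNIV (\<lambda>_. \<rho>'))"
    and N: "N \<in> null_sets \<rho>" "inj_on (profile mk kn u) (- N)"
    and N': "N' \<in> null_sets \<rho>'" "inj_on (profile mk' kn' u') (- N')"
    and law: "distr (\<rho> \<Otimes>\<^sub>M \<rho>) borel (pair_profile mk kn u) = distr (\<rho>' \<Otimes>\<^sub>M \<rho>') borel (pair_profile mk' kn' u')"
  shows "kernel_iso \<rho> mk kn \<rho>' mk' kn'"
proof -
  interpret X: borel_mck_space \<rho> mk kn by fact
  interpret Y: borel_mck_space \<rho>' mk' kn' by fact
  define J where "J = profile mk kn u"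
  define J' where "J' = profile mk' kn' u'"
  have J[measurable]: "J \<in> borel_measurable \<rho>"
    unfolding J_def by (rule X.profile_measurable) (auto simp: u)
  have J'[measurable]: "J' \<in> borel_measurable \<rho>'"
    unfolding J'_def by (rule Y.profile_measurable) (auto simp: u')
  have PP[measurable]: "pair_profile mk kn u \<in> borel_measurable (\<rho> \<Otimes>\<^sub>M \<rho>)"
    by (rule X.pair_profile_measurable) (auto simp: u)
  have PP'[measurable]: "pair_profile mk' kn' u' \<in> borel_measurable (\<rho>' \<Otimes>\<^sub>M \<rho>')"
    by (rule Y.pair_profile_measurable) (auto simp: u')
  have law1: "distr \<rho> borel J = distr \<rho>' borel J'"
    using distr_fst_factor[OF X.prob_space_axioms J PP] distr_fst_factor[OF Y.prob_space_axioms J' PP'] law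
    by (simp add: pair_profile_def J_def J'_def)
  obtain V where V: "V \<in> borel_measurable borel" "AE z in \<rho>. V (J z) = z"
    using borel_left_inverse[OF X.sets_eq X.prob_space_axioms _ N, folded J_def] J measurable_cong_sets[OF X.sets_eq refl] by blast
  obtain V' where V': "V' \<in> borel_measurable borel" "AE z in \<rho>'. V' (J' z) = z"
    using borel_left_inverse[OF Y.sets_eq Y.prob_space_axioms _ N', folded J'_def] J' measurable_cong_sets[OF Y.sets_eq refl] by blast
  have Vm[measurable]: "V \<in> borel \<rightarrow>\<^sub>M \<rho>" "V' \<in> borel \<rightarrow>\<^sub>M \<rho>'"
    using V(1) V'(1) measurable_cong_sets[OF refl X.sets_eq] measurable_cong_sets[OF refl Y.sets_eq] by blast+
  define U where "U z = V' (J z)" for z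
  define W where "W z = V (J' z)" for z
  have U[measurable]: "U \<in> \<rho> \<rightarrow>\<^sub>M \<rho>'" and W[measurable]: "W \<in> \<rho>' \<rightarrow>\<^sub>M \<rho>"
    unfolding U_def W_def by measurable
  have JU: "AE z in \<rho>. J' (U z) = J z"
    unfolding U_def by (rule AE_right_inverse[where L=J and L'=J' and W'=V' and M=\<rho> and M'=\<rho>', OF J J' Vm(2) law1 V'(2)])
  have J'W: "AE z in \<rho>'. J (W z) = J' z"
    unfolding W_def by (rule AE_right_inverse[where L=J' and L'=J and W'=V and M=\<rho>' and M'=\<rho>, OF J' J Vm(1) law1[symmetric] V(2)])
  have dU: "distr \<rho> \<rho>' U = \<rho>'"
    unfolding U_def[abs_def] by (rule distr_via_inverse[where L=J and L'=J' and W'=V' and M=\<rho> and M'=\<rho>', OF J J' Vm(2) law1 V'(2)])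
  have dW: "distr \<rho>' \<rho> W = \<rho>"
    unfolding W_def[abs_def] by (rule distr_via_inverse[where L=J' and L'=J and W'=V and M=\<rho>' and M'=\<rho>, OF J' J Vm(1) law1[symmetric] V(2)])
  have iso: "meas_iso \<rho> \<rho>' U"
    unfolding meas_iso_def
  proof (intro conjI exI[of _ W])
    show "AE z in \<rho>. W (U z) = z"
      using JU V(2) by eventually_elim (simp add: W_def)
    show "AE z in \<rho>'. U (W z) = z"
      using J'W V'(2) by eventually_elim (simp add: U_def)
  qed (use U W dU dW in auto)
  have marks: "AE z in \<rho>. mk \<alpha> z = mk' \<alpha> (U z)" for \<alpha>
    using JU
  proof eventually_elim
    case (elim z)
    from fun_cong[OF elim, of "Inl \<alpha>"] show ?case by (simp add: J_def J'_def profile_def)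
  qed
  \<comment> \<open>Both kernels are the same function of the two profiles, because the law of a pair's profiles
    and kernel values is the same on both sides.\<close>
  have kernels: "AE p in \<rho> \<Otimes>\<^sub>M \<rho>. kn c (fst p) (snd p) = kn' c (U (fst p)) (U (snd p))" for c
  proof -
    \<comment> \<open>\<open>h\<close> is this common function, built from the inverse
      \<open>V\<close> on the first space. The event below is Borel, so whether it has full mass is
      decided by the pair law alone.\<close>
    define h where "h d = kn c (V (fst d)) (V (fst (snd d)))" for d :: "('a + bool \<times> nat \<times> 'b \<Rightarrow> real) \<times> ('a + bool \<times> nat \<times> 'b \<Rightarrow> real) \<times> ('b \<Rightarrow> real)"
    have sD: "{d \<in> space borel. snd (snd d) c = h d} \<in> sets borel"
    proof -
      have m1: "(\<lambda>d. snd (snd d)) \<in> (borel :: (('a + bool \<times> nat \<times> 'b \<Rightarrow> real) \<times> ('a + bool \<times> nat \<times> 'b \<Rightarrow> real) \<times> ('b \<Rightarrow> real)) measure) \<rightarrow>\<^sub>M (borel :: ('b \<Rightarrow> real) measure)" 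
        by (intro borel_measurable_continuous_onI continuous_intros)
      have m2: "(\<lambda>d. V (fst d)) \<in> borel \<rightarrow>\<^sub>M \<rho>" "(\<lambda>d. V (fst (snd d))) \<in> borel \<rightarrow>\<^sub>M \<rho>"
        by (rule measurable_compose[OF _ Vm(1)], intro borel_measurable_continuous_onI continuous_intros)+
      have [measurable]: "h \<in> borel_measurable borel"
        unfolding h_def[abs_def] by (rule X.kn_measurable[OF m2])
      have [measurable]: "(\<lambda>d. snd (snd d) c) \<in> borel_measurable (borel :: (('a + bool \<times> nat \<times> 'b \<Rightarrow> real) \<times> ('a + bool \<times> nat \<times> 'b \<Rightarrow> real) \<times> ('b \<Rightarrow> real)) measure)"
        by (rule measurable_compose[OF m1 measurable_product_coordinates])
      show ?thesis by measurable
    qed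
    have "AE p in \<rho> \<Otimes>\<^sub>M \<rho>. snd (snd (pair_profile mk kn u p)) c = h (pair_profile mk kn u p)"
      using AE_pair_both[OF X.prob_space_axioms V(2)]
      by eventually_elim (auto simp: h_def pair_profile_def J_def)
    then have "AE d in distr (\<rho> \<Otimes>\<^sub>M \<rho>) borel (pair_profile mk kn u). snd (snd d) c = h d"
      by (subst AE_distr_iff[OF PP sD])
    then have "AE p in \<rho>' \<Otimes>\<^sub>M \<rho>'. snd (snd (pair_profile mk' kn' u' p)) c = h (pair_profile mk' kn' u' p)"
      unfolding law by (subst (asm) AE_distr_iff[OF PP' sD])
    then have *: "AE p in \<rho>' \<Otimes>\<^sub>M \<rho>'. kn' c (fst p) (snd p) = kn c (V (J' (fst p))) (V (J' (snd p)))"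
      by (simp add: pair_profile_def h_def J'_def)
    have "AE p in \<rho> \<Otimes>\<^sub>M \<rho>. kn' c (U (fst p)) (U (snd p)) = kn c (V (J' (U (fst p)))) (V (J' (U (snd p))))"
      by (rule AE_pair_map[OF Y.prob_space_axioms U dU *])
    \<comment> \<open>Since \<open>J' (U z) = J z\<close> and \<open>V (J z) = z\<close>, the
      representation on the second space, pulled back along \<open>U\<close>, becomes the kernel of
      the first.\<close>
    moreover have "AE p in \<rho> \<Otimes>\<^sub>M \<rho>. V (J' (U (fst p))) = fst p \<and> V (J' (U (snd p))) = snd p"
      by (rule AE_pair_both[OF X.prob_space_axioms]) (use JU V(2) in eventually_elim, simp)
    ultimately show ?thesis by eventually_elim simp
  qed
  show ?thesis
    unfolding kernel_iso_def using iso marks kernels by blast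
qed

theorem kernel_iso_if_sample_array_law_eq:
  fixes \<rho> :: "'o::polish_space measure" and mk :: "'a::countable \<Rightarrow> 'o \<Rightarrow> real" and kn :: "'b::countable \<Rightarrow> 'o \<Rightarrow> 'o \<Rightarrow> real"
    and \<rho>' :: "'p::polish_space measure" and mk' :: "'a \<Rightarrow> 'p \<Rightarrow> real" and kn' :: "'b \<Rightarrow> 'p \<Rightarrow> 'p \<Rightarrow> real"
  assumes X: "borel_mck_space \<rho> mk kn" "rcm_pure \<rho> mk kn"
    and Y: "borel_mck_space \<rho>' mk' kn'" "rcm_pure \<rho>' mk' kn'"
    and law: "distr (PiM UNIV (\<lambda>_. \<rho>)) borel (sample_array mk kn) = distr (PiM UNIV (\<lambda>_. \<rho>')) borel (sample_array mk' kn')"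
  shows "kernel_iso \<rho> mk kn \<rho>' mk' kn'"
proof -
  interpret X: borel_mck_space \<rho> mk kn by fact
  interpret Y: borel_mck_space \<rho>' mk' kn' by fact
  obtain E :: "(('a + bool \<times> nat \<times> 'b \<Rightarrow> real) \<times> ('a + bool \<times> nat \<times> 'b \<Rightarrow> real) \<times> ('b \<Rightarrow> real)) set set"
    where E: "countable E" "Int_stable E" "UNIV \<in> E" "E \<subseteq> sets borel" "sets borel = sigma_sets UNIV E"
    by (rule ex_countable_Int_stable_generator)
  have sQ: "sets (X.S \<Otimes>\<^sub>M X.S2) = sets borel" "sets (Y.S \<Otimes>\<^sub>M Y.S2) = sets borel"
    by (simp_all only: sets_pair_measure_cong[OF X.sets_S X.sets_S2] sets_pair_measure_cong[OF Y.sets_S Y.sets_S2] borel_prod)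
  \<comment> \<open>The matched points are pairs of a reference sample and a pair sample, and the
    maps to be matched send them to their interleaved arrays.\<close>
  obtain x y where 
    x: "(\<exists>N\<in>null_sets \<rho>. inj_on (profile mk kn (fst x)) (- N)) \<and> fst x \<in> space X.S \<and>
    (\<forall>B\<in>E. (\<lambda>n. (\<Sum>i<n. indicator B (pair_profile mk kn (fst x) (snd x i))) / real n)
     \<longlonglongrightarrow> measure (distr X.\<rho>2 borel (pair_profile mk kn (fst x))) B)"
    and y: "(\<exists>N\<in>null_sets \<rho>'. inj_on (profile mk' kn' (fst y)) (- N)) \<and> fst y \<in> space Y.S \<and>
    (\<forall>B\<in>E. (\<lambda>n. (\<Sum>i<n. indicator B (pair_profile mk' kn' (fst y) (snd y i))) / real n)
     \<longlonglongrightarrow> measure (distr Y.\<rho>2 borel (pair_profile mk' kn' (fst y))) B)"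
    and xy: "sample_array mk kn (interleave (fst x) (snd x)) = sample_array mk' kn' (interleave (fst y) (snd y))"
    by (rule matching_points[OF sQ(1) X.Q.prob_space_axioms sQ(2) Y.Q.prob_space_axioms
          X.sample_array_interleave_measurable Y.sample_array_interleave_measurable _
          X.AE_good_sample[OF X(2) E(1,4)] Y.AE_good_sample[OF Y(2) E(1,4)]])
       (simp only: X.distr_sample_array_interleave Y.distr_sample_array_interleave law)
  note eq = sample_array_eq_imp_pair_profile_eq[OF xy]
  have PP: "pair_profile mk kn (fst x) \<in> borel_measurable X.\<rho>2"
    by (rule X.pair_profile_measurable) (use x in auto)
  have PP': "pair_profile mk' kn' (fst y) \<in> borel_measurable Y.\<rho>2"
    by (rule Y.pair_profile_measurable) (use y in auto)
  interpret DX: prob_space "distr X.\<rho>2 borel (pair_profile mk kn (fst x))"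
    by (rule X.pair.prob_space_distr[OF PP])
  interpret DY: prob_space "distr Y.\<rho>2 borel (pair_profile mk' kn' (fst y))"
    by (rule Y.pair.prob_space_distr[OF PP'])
  have "distr X.\<rho>2 borel (pair_profile mk kn (fst x)) = distr Y.\<rho>2 borel (pair_profile mk' kn' (fst y))"
  proof (rule borel_measure_eqI_Int_stable[OF E(2,3,5)])
    fix B assume "B \<in> E"
    with x y have l: "(\<lambda>n. (\<Sum>i<n. indicator B (pair_profile mk kn (fst x) (snd x i))) / real n)
         \<longlonglongrightarrow> measure (distr X.\<rho>2 borel (pair_profile mk kn (fst x))) B"
      "(\<lambda>n. (\<Sum>i<n. indicator B (pair_profile mk' kn' (fst y) (snd y i))) / real n)
         \<longlonglongrightarrow> measure (distr Y.\<rho>2 borel (pair_profile mk' kn' (fst y))) B"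
      by blast+
    \<comment> \<open>By \<open>eq\<close> the two sequences of frequencies are the same sequence,
      so their limits agree.\<close>
    have "measure (distr X.\<rho>2 borel (pair_profile mk kn (fst x))) B
        = measure (distr Y.\<rho>2 borel (pair_profile mk' kn' (fst y))) B"
      using l(1) l(2) unfolding eq by (rule LIMSEQ_unique)
    then show "emeasure (distr X.\<rho>2 borel (pair_profile mk kn (fst x))) B
        = emeasure (distr Y.\<rho>2 borel (pair_profile mk' kn' (fst y))) B"
      by (simp add: DX.emeasure_eq_measure DY.emeasure_eq_measure)
  qed (auto simp: DX.emeasure_eq_measure)
  with x y show ?thesis
    using kernel_iso_if_pair_profile_law_eq[OF X(1) Y(1)] by blast
qed

subsection \<open>Quotients, embeddings and joinings\<close>

lemma dense_sequence_if_compact: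
  assumes "compact (UNIV :: ('a::metric_space) set)"
  obtains d :: "nat \<Rightarrow> 'a::metric_space" where "\<And>x e. e > 0 \<Longrightarrow> \<exists>n. dist x (d n) < e"
proof -
  have "\<forall>n::nat. \<exists>K. finite K \<and> (UNIV :: 'a set) \<subseteq> (\<Union>x\<in>K. ball x (1 / Suc n))"
  proof
    fix n :: nat
    have "1 / real (Suc n) > 0" by simp
    with seq_compact_imp_totally_bounded[of "UNIV :: 'a set"] assms
    show "\<exists>K. finite K \<and> (UNIV :: 'a set) \<subseteq> (\<Union>x\<in>K. ball x (1 / Suc n))"
      unfolding compact_eq_seq_compact_metric by blast
  qed
  from choice[OF this] obtain K where K: "\<And>n::nat. finite (K n)"
    "\<And>n. (UNIV :: 'a set) \<subseteq> (\<Union>x\<in>K n. ball x (1 / Suc n))"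
    by blast
  define D where "D = (\<Union>n. K n)"
  have D: "countable D"
    unfolding D_def using K(1) by (auto intro: countable_finite)
  show thesis
  proof
    fix x :: 'a and e :: real assume "e > 0"
    then obtain n where n: "1 / Suc n < e" using nat_approx_posE by blast
    obtain y where "y \<in> K n" "dist y x < 1 / Suc n" using K(2)[of n] by (auto simp: subset_eq)
    then have "y \<in> D" "dist x y < e" using n by (auto simp: D_def dist_commute)
    then show "\<exists>n. dist x (from_nat_into D n) < e"
      using from_nat_into_surj[OF D] by metis
  qed
qed

text \<open>Compactness of the type stands in for the missing class constraint of second countability.\<close>

lemma borel_measurable_dist_if_compact:
  fixes f g :: "'o \<Rightarrow> 'a::metric_space"
  assumes c: "compact (UNIV :: 'a set)" and m: "f \<in> borel_measurable M" "g \<in> borel_measurable M"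
  shows "(\<lambda>x. dist (f x) (g x)) \<in> borel_measurable M"
proof -
  obtain d :: "nat \<Rightarrow> 'a" where d: "\<And>x e. e > 0 \<Longrightarrow> \<exists>n. dist x (d n) < e"
    by (rule dense_sequence_if_compact[OF c]) blast
  have dm: "(\<lambda>x. dist x a) \<in> borel_measurable borel" for a :: 'a
    by (intro borel_measurable_continuous_onI continuous_intros)
  have [measurable]: "(\<lambda>x. dist (h x) a) \<in> borel_measurable M" if "h \<in> borel_measurable M" for h and a :: 'a
    using measurable_compose[OF that dm] .
  note [measurable] = m
  \<comment> \<open>The triangle inequality gives one bound, a point \<open>d n\<close> close to
    \<open>x\<close> the other. The formula reduces joint measurability to distances from fixed
    points, which are continuous.\<close>
  have eq: "dist x y = (INF n. dist x (d n) + dist y (d n))" for x y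
  proof (rule antisym)
    show "dist x y \<le> (INF n. dist x (d n) + dist y (d n))"
      by (intro cINF_greatest) (auto simp: dist_triangle2)
    show "(INF n. dist x (d n) + dist y (d n)) \<le> dist x y"
    proof (rule field_le_epsilon)
      fix e :: real assume "e > 0"
      then obtain n where n: "dist x (d n) < e / 2" using d[of "e/2"] by auto
      have "(INF n. dist x (d n) + dist y (d n)) \<le> dist x (d n) + dist y (d n)"
        by (intro cINF_lower bdd_belowI[of _ 0]) auto
      also have "\<dots> \<le> dist x y + e"
        using n dist_triangle[of y "d n" x] by (simp add: dist_commute)
      finally show "(INF n. dist x (d n) + dist y (d n)) \<le> dist x y + e" .
    qed
  qed
  have "(\<lambda>x. dist (f x) (g x)) = (\<lambda>x. INF n. dist (f x) (d n) + dist (g x) (d n))"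
    by (rule ext) (rule eq)
  also have "\<dots> \<in> borel_measurable M"
    by (intro borel_measurable_cINF bdd_belowI[of _ 0]) auto
  finally show ?thesis .
qed

text \<open>Distances to a dense sequence determine a point, so \<open>e\<close> is continuous and
  injective; closed sets of a compact space have compact images, hence the inverse is Borel. The
  identity \<open>g (e x) = x\<close> holds at every point, unlike the almost sure inverse of
  \<open>borel_left_inverse\<close>, so one \<open>g\<close> serves every measure.\<close>

lemma borel_embedding_if_compact:
  assumes c: "compact (UNIV :: ('a::metric_space) set)"
  obtains e :: "'a::metric_space \<Rightarrow> nat \<Rightarrow> real" and g where "e \<in> borel_measurable borel" "g \<in> borel_measurable borel" "\<And>x. g (e x) = x"
proof -
  obtain d :: "nat \<Rightarrow> 'a" where d: "\<And>x e. e > 0 \<Longrightarrow> \<exists>n. dist x (d n) < e"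
    by (rule dense_sequence_if_compact[OF c]) blast
  define e where "e x = (\<lambda>n. dist x (d n))" for x
  define g where "g y = (if y \<in> range e then inv e y else undefined)" for y
  have "inj e"
  proof (rule injI, rule ccontr)
    fix x y assume eq: "e x = e y" and "x \<noteq> y"
    then obtain n where n: "dist x (d n) < dist x y / 2" using d[of "dist x y / 2"] by auto
    moreover have "dist y (d n) = dist x (d n)" using fun_cong[OF eq, of n] by (simp add: e_def)
    ultimately show False using dist_triangle2[of x y "d n"] by linarith
  qed
  then have g: "g (e x) = x" for x by (simp add: g_def)
  have ce: "continuous_on A e" for A
    unfolding e_def[abs_def] by (intro continuous_on_coordinatewise_then_product continuous_intros)
  have im: "e ` F \<in> sets borel" if "closed F" for F
  proof -
    have "compact F" using compact_Int_closed[OF c that] by simp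
    then show ?thesis by (intro borel_compact compact_continuous_image ce)
  qed
  show thesis
  proof
    show "e \<in> borel_measurable borel" by (intro borel_measurable_continuous_onI ce)
    show "g \<in> borel_measurable borel"
      unfolding borel_eq_closed[where 'a='a]
    proof (rule measurable_measure_of)
      fix F :: "'a set" assume "F \<in> {F. closed F}"
      then have F: "closed F" by simp
      have "g -` F = e ` F \<union> (if undefined \<in> F then - range e else {})"
      proof (intro set_eqI iffI)
        fix y assume y: "y \<in> g -` F"
        then show "y \<in> e ` F \<union> (if undefined \<in> F then - range e else {})"
        proof (cases "y \<in> range e")
          case True
          then obtain x where x: "y = e x" by blast
          with y have "x \<in> F" by (simp add: g)
          with x show ?thesis by blast
        qed (use y in \<open>auto simp: g_def\<close>)
      next
        fix y assume "y \<in> e ` F \<union> (if undefined \<in> F then - range e else {})"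
        then consider x where "x \<in> F" "y = e x" | "undefined \<in> F" "y \<notin> range e"
          by (auto split: if_splits)
        then show "y \<in> g -` F"
        proof cases
          case 1 then show ?thesis by (simp add: g)
        qed (simp add: g_def)
      qed
      also have "\<dots> \<in> sets borel" using im[OF F] im[of UNIV] by auto
      finally show "g -` F \<inter> space borel \<in> sets borel" by simp
    qed auto
  qed (rule g)
qed

section \<open>Laws of sample arrays under measure-preserving maps\<close>

lemma measurable_PiM_map:
  assumes q: "q \<in> M \<rightarrow>\<^sub>M N"
  shows "(\<lambda>w i. q (w i)) \<in> PiM UNIV (\<lambda>_. M) \<rightarrow>\<^sub>M PiM UNIV (\<lambda>_. N)"
proof (rule measurable_PiM_single')
  show "(\<lambda>w. q (w i)) \<in> PiM UNIV (\<lambda>_. M) \<rightarrow>\<^sub>M N" for i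
    by (rule measurable_compose[OF _ q]) (rule measurable_component_singleton, simp)
  show "(\<lambda>w i. q (w i)) \<in> space (PiM UNIV (\<lambda>_. M)) \<rightarrow> (UNIV \<rightarrow>\<^sub>E space N)"
    using measurable_space[OF q] by (auto simp: space_PiM PiE_iff)
qed

lemma distr_PiM_map:
  assumes M: "prob_space M" and q: "q \<in> M \<rightarrow>\<^sub>M N" and N: "distr M N q = N"
  shows "distr (PiM UNIV (\<lambda>_. M)) (PiM UNIV (\<lambda>_. N)) (\<lambda>w i. q (w i)) = PiM UNIV (\<lambda>_. N)"
proof -
  interpret M: prob_space M by fact
  interpret N: prob_space N using M.prob_space_distr[OF q] N by simp
  interpret PM: product_prob_space "\<lambda>_. M" "UNIV" by unfold_locales
  interpret PN: product_prob_space "\<lambda>_. N" "UNIV" by unfold_locales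
  have qm: "(\<lambda>w i. q (w i)) \<in> PiM UNIV (\<lambda>_. M) \<rightarrow>\<^sub>M PiM UNIV (\<lambda>_. N)"
    by (rule measurable_PiM_map[OF q])
  show ?thesis
  proof (rule PN.PiM_eq)
    fix J F assume J: "finite J" "\<And>j. j \<in> J \<Longrightarrow> F j \<in> sets N"
    have "(\<lambda>w i. q (w i)) -` prod_emb UNIV (\<lambda>_. N) J (Pi\<^sub>E J F) \<inter> space (PiM UNIV (\<lambda>_. M))
        = prod_emb UNIV (\<lambda>_. M) J (\<Pi>\<^sub>E j\<in>J. q -` F j \<inter> space M)"
      using measurable_space[OF q] by (auto simp: prod_emb_def space_PiM PiE_iff)
    then have "emeasure (distr (PiM UNIV (\<lambda>_. M)) (PiM UNIV (\<lambda>_. N)) (\<lambda>w i. q (w i))) (prod_emb UNIV (\<lambda>_. N) J (Pi\<^sub>E J F))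
       = (\<Prod>j\<in>J. emeasure M (q -` F j \<inter> space M))"
      using J q by (subst emeasure_distr[OF qm]) (auto intro!: sets_PiM_I PM.emeasure_PiM_emb)
    also have "\<dots> = (\<Prod>j\<in>J. emeasure (distr M N q) (F j))"
      using J by (intro prod.cong) (auto simp: emeasure_distr[OF q])
    finally show "emeasure (distr (PiM UNIV (\<lambda>_. M)) (PiM UNIV (\<lambda>_. N)) (\<lambda>w i. q (w i))) (prod_emb UNIV (\<lambda>_. N) J (Pi\<^sub>E J F))
       = (\<Prod>j\<in>J. emeasure N (F j))" unfolding N .
  qed simp
qed

text \<open>For \<open>i = j\<close> the pair would lie on the diagonal, which can be null for the
  product measure. Distinct indices are what lets an identity of kernels that holds almost
  everywhere reach the entries of a sampled array.\<close>

lemma distr_PiM_pair: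
  assumes M: "prob_space M" and ij: "i \<noteq> j"
  shows "distr (PiM UNIV (\<lambda>_. M)) (M \<Otimes>\<^sub>M M) (\<lambda>w. (w i, w j)) = M \<Otimes>\<^sub>M M"
proof -
  interpret M: prob_space M by fact
  interpret P: product_prob_space "\<lambda>_. M" "UNIV" by unfold_locales
  have m: "(\<lambda>w. (w i, w j)) \<in> PiM UNIV (\<lambda>_. M) \<rightarrow>\<^sub>M M \<Otimes>\<^sub>M M" by measurable
  show ?thesis
  proof (rule pair_measure_eqI[symmetric])
    fix A B assume A: "A \<in> sets M" and B: "B \<in> sets M"
    let ?X = "\<lambda>l. if l = i then A else B"
    have "emeasure (PiM UNIV (\<lambda>_. M)) {w \<in> space (PiM UNIV (\<lambda>_. M)). \<forall>l\<in>{i, j}. w l \<in> ?X l}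
        = (\<Prod>l\<in>{i, j}. emeasure M (?X l))"
      using A B by (intro P.emeasure_PiM_Collect) auto
    also have "\<dots> = emeasure M A * emeasure M B" using ij by simp
    also have "{w \<in> space (PiM UNIV (\<lambda>_. M)). \<forall>l\<in>{i, j}. w l \<in> ?X l}
        = (\<lambda>w. (w i, w j)) -` (A \<times> B) \<inter> space (PiM UNIV (\<lambda>_. M))"
      using ij by auto
    finally show "emeasure M A * emeasure M B = emeasure (distr (PiM UNIV (\<lambda>_. M)) (M \<Otimes>\<^sub>M M) (\<lambda>w. (w i, w j))) (A \<times> B)"
      using A B by (subst emeasure_distr[OF m]) auto
  qed (simp_all add: M.sigma_finite_measure_axioms)
qed

text \<open>The array has countably many entries, so almost sure equality of each suffices: marks
  follow from one coordinate, off-diagonal kernels from two distinct coordinates, and diagonal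
  entries are 0 on both sides. Twin-free quotients and embeddings are both instances.\<close>

lemma distr_sample_array_quotient:
  fixes mk :: "'i::countable \<Rightarrow> 'o \<Rightarrow> real" and kn :: "'j::countable \<Rightarrow> 'o \<Rightarrow> 'o \<Rightarrow> real"
  assumes X: "mck_space M mk kn" and Y: "mck_space N mk' kn'"
    and q: "q \<in> M \<rightarrow>\<^sub>M N" "distr M N q = N"
    and marks: "\<And>\<alpha>. AE z in M. mk \<alpha> z = mk' \<alpha> (q z)"
    and kernels: "\<And>c. AE p in M \<Otimes>\<^sub>M M. kn c (fst p) (snd p) = kn' c (q (fst p)) (q (snd p))"
  shows "distr (PiM UNIV (\<lambda>_. M)) borel (sample_array mk kn) = distr (PiM UNIV (\<lambda>_. N)) borel (sample_array mk' kn')"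
proof -
  interpret X: mck_prob_space M mk kn
    using X by (simp add: mck_prob_space_def mck_prob_space_axioms_def mck_space_def)
  interpret Y: mck_prob_space N mk' kn'
    using Y by (simp add: mck_prob_space_def mck_prob_space_axioms_def mck_space_def)
  let ?M = "PiM (UNIV :: nat set) (\<lambda>_. M)" and ?N = "PiM (UNIV :: nat set) (\<lambda>_. N)"
  have qm: "(\<lambda>w i. q (w i)) \<in> ?M \<rightarrow>\<^sub>M ?N"
    by (rule measurable_PiM_map[OF q(1)])
  have "AE w in ?M. sample_array mk kn w e = sample_array mk' kn' (\<lambda>i. q (w i)) e" for e
  proof (cases e)
    case (Inl a)
    obtain i \<alpha> where a: "a = (i, \<alpha>)" by force
    have "AE w in ?M. mk \<alpha> (w i) = mk' \<alpha> (q (w i))"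
      by (rule AE_PiM_component) (auto simp: X.prob_space_axioms marks)
    then show ?thesis by (simp add: Inl a sample_array_def)
  next
    case (Inr a)
    obtain i j c where a: "a = (i, j, c)" by (cases a)
    show ?thesis
    proof (cases "i = j")
      case False
      have "AE p in distr ?M (M \<Otimes>\<^sub>M M) (\<lambda>w. (w i, w j)). kn c (fst p) (snd p) = kn' c (q (fst p)) (q (snd p))"
        using kernels unfolding distr_PiM_pair[OF X.prob_space_axioms False] .
      then have "AE w in ?M. kn c (fst (w i, w j)) (snd (w i, w j)) = kn' c (q (fst (w i, w j))) (q (snd (w i, w j)))"
        by (rule AE_distrD[rotated]) simp
      then show ?thesis by (simp add: Inr a sample_array_def False)
    qed (simp add: Inr a sample_array_def)
  qed
  then have "AE w in ?M. \<forall>e. sample_array mk kn w e = sample_array mk' kn' (\<lambda>i. q (w i)) e"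
    unfolding AE_all_countable by blast
  then have ae: "AE w in ?M. sample_array mk kn w = sample_array mk' kn' (\<lambda>i. q (w i))"
    by eventually_elim auto
  have "distr ?N borel (sample_array mk' kn') = distr (distr ?M ?N (\<lambda>w i. q (w i))) borel (sample_array mk' kn')"
    unfolding distr_PiM_map[OF X.prob_space_axioms q] ..
  also have "\<dots> = distr ?M borel (\<lambda>w. sample_array mk' kn' (\<lambda>i. q (w i)))"
    by (subst distr_distr[OF _ qm]) (auto simp: comp_def)
  also have "\<dots> = distr ?M borel (sample_array mk kn)"
    using qm by (intro distr_cong_AE) (use ae in \<open>auto elim: eventually_mono\<close>)
  finally show ?thesis by simp
qed

section \<open>Kernel isomorphism: composition, inversion and embeddings\<close>

lemma kernel_iso_trans:
  assumes ps: "prob_space \<rho>" "prob_space \<rho>'"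
    and "kernel_iso \<rho> mk kn \<rho>' mk' kn'" "kernel_iso \<rho>' mk' kn' \<rho>'' mk'' kn''"
  shows "kernel_iso \<rho> mk kn \<rho>'' mk'' kn''"
proof -
  interpret P: prob_space \<rho> by fact
  interpret P': prob_space \<rho>' by fact
  obtain U where U: "meas_iso \<rho> \<rho>' U" "\<And>\<alpha>. AE z in \<rho>. mk \<alpha> z = mk' \<alpha> (U z)"
    "\<And>c. AE p in \<rho> \<Otimes>\<^sub>M \<rho>. kn c (fst p) (snd p) = kn' c (U (fst p)) (U (snd p))"
    using assms(3) unfolding kernel_iso_def by blast
  obtain U' where U': "meas_iso \<rho>' \<rho>'' U'" "\<And>\<alpha>. AE z in \<rho>'. mk' \<alpha> z = mk'' \<alpha> (U' z)"
    "\<And>c. AE p in \<rho>' \<Otimes>\<^sub>M \<rho>'. kn' c (fst p) (snd p) = kn'' c (U' (fst p)) (U' (snd p))"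
    using assms(4) unfolding kernel_iso_def by blast
  obtain V where V: "U \<in> \<rho> \<rightarrow>\<^sub>M \<rho>'" "distr \<rho> \<rho>' U = \<rho>'" "V \<in> \<rho>' \<rightarrow>\<^sub>M \<rho>" "distr \<rho>' \<rho> V = \<rho>"
    "AE z in \<rho>. V (U z) = z" "AE z in \<rho>'. U (V z) = z"
    using U(1) unfolding meas_iso_def by blast
  obtain V' where V': "U' \<in> \<rho>' \<rightarrow>\<^sub>M \<rho>''" "distr \<rho>' \<rho>'' U' = \<rho>''" "V' \<in> \<rho>'' \<rightarrow>\<^sub>M \<rho>'" "distr \<rho>'' \<rho>' V' = \<rho>'"
    "AE z in \<rho>'. V' (U' z) = z" "AE z in \<rho>''. U' (V' z) = z"
    using U'(1) unfolding meas_iso_def by blast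
  have pull: "AE z in \<rho>. P (U z)" if "AE z in \<rho>'. P z" for P
    using that AE_distrD[OF V(1), of P] unfolding V(2) by blast
  have pull': "AE z in \<rho>''. P (V' z)" if "AE z in \<rho>'. P z" for P
    using that AE_distrD[OF V'(3), of P] unfolding V'(4) by blast
  have pull2: "AE p in \<rho> \<Otimes>\<^sub>M \<rho>. P (U (fst p)) (U (snd p))" if "AE p in \<rho>' \<Otimes>\<^sub>M \<rho>'. P (fst p) (snd p)" for P
    by (rule AE_pair_map[OF ps(2) V(1,2) that])
  show ?thesis
    unfolding kernel_iso_def meas_iso_def
  proof (intro exI[of _ "\<lambda>z. U' (U z)"] conjI allI exI[of _ "\<lambda>z. V (V' z)"])
    show "(\<lambda>z. U' (U z)) \<in> \<rho> \<rightarrow>\<^sub>M \<rho>''" "(\<lambda>z. V (V' z)) \<in> \<rho>'' \<rightarrow>\<^sub>M \<rho>"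
      by (rule measurable_compose[OF V(1) V'(1)], rule measurable_compose[OF V'(3) V(3)])
    show "distr \<rho> \<rho>'' (\<lambda>z. U' (U z)) = \<rho>''"
      using distr_distr[OF V'(1) V(1)] unfolding V(2) V'(2) comp_def by (rule sym)
    show "distr \<rho>'' \<rho> (\<lambda>z. V (V' z)) = \<rho>"
      using distr_distr[OF V(3) V'(3)] unfolding V(4) V'(4) comp_def by (rule sym)
    show "AE z in \<rho>. V (V' (U' (U z))) = z"
      using pull[OF V'(5)] V(5) by eventually_elim simp
    show "AE z in \<rho>''. U' (U (V (V' z))) = z"
      using pull'[OF V(6)] V'(6) by eventually_elim simp
    show "AE z in \<rho>. mk \<alpha> z = mk'' \<alpha> (U' (U z))" for \<alpha>
      using U(2)[of \<alpha>] pull[OF U'(2)[of \<alpha>]] by eventually_elim simp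
    show "AE p in \<rho> \<Otimes>\<^sub>M \<rho>. kn c (fst p) (snd p) = kn'' c (U' (U (fst p))) (U' (U (snd p)))" for c
      using U(3)[of c] pull2[OF U'(3)[of c]] by eventually_elim simp
  qed
qed

lemma kernel_iso_sym:
  assumes ps: "prob_space \<rho>" "prob_space \<rho>'" and "kernel_iso \<rho> mk kn \<rho>' mk' kn'"
  shows "kernel_iso \<rho>' mk' kn' \<rho> mk kn"
proof -
  interpret P: prob_space \<rho> by fact
  obtain U where U: "meas_iso \<rho> \<rho>' U" "\<And>\<alpha>. AE z in \<rho>. mk \<alpha> z = mk' \<alpha> (U z)"
    "\<And>c. AE p in \<rho> \<Otimes>\<^sub>M \<rho>. kn c (fst p) (snd p) = kn' c (U (fst p)) (U (snd p))"
    using assms(3) unfolding kernel_iso_def by blast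
  obtain V where V: "U \<in> \<rho> \<rightarrow>\<^sub>M \<rho>'" "distr \<rho> \<rho>' U = \<rho>'" "V \<in> \<rho>' \<rightarrow>\<^sub>M \<rho>" "distr \<rho>' \<rho> V = \<rho>"
    "AE z in \<rho>. V (U z) = z" "AE z in \<rho>'. U (V z) = z"
    using U(1) unfolding meas_iso_def by blast
  have pull: "AE z in \<rho>'. P (V z)" if "AE z in \<rho>. P z" for P
    using that AE_distrD[OF V(3), of P] unfolding V(4) by blast
  have pull2: "AE p in \<rho>' \<Otimes>\<^sub>M \<rho>'. P (V (fst p)) (V (snd p))" if "AE p in \<rho> \<Otimes>\<^sub>M \<rho>. P (fst p) (snd p)" for P
    by (rule AE_pair_map[OF ps(1) V(3,4) that])
  have marks: "AE z in \<rho>'. mk' \<alpha> z = mk \<alpha> (V z)" for \<alpha>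
    using pull[OF U(2)[of \<alpha>]] V(6) by eventually_elim simp
  have kernels: "AE p in \<rho>' \<Otimes>\<^sub>M \<rho>'. kn' c (fst p) (snd p) = kn c (V (fst p)) (V (snd p))" for c
    using pull2[OF U(3)[of c]] AE_pair_both[OF ps(2) V(6)] by eventually_elim simp
  show ?thesis
    unfolding kernel_iso_def meas_iso_def using V marks kernels by blast
qed

text \<open>Pure joinings live on a type that is merely metric; this moves them to a Polish type.
  Composing marks and kernels with the everywhere defined left inverse \<open>g\<close> gives them
  values outside the range of \<open>e\<close> too.\<close>

lemma kernel_iso_pure_embedding:
  fixes mk :: "'i::countable \<Rightarrow> 'o \<Rightarrow> real" and kn :: "'j::countable \<Rightarrow> 'o \<Rightarrow> 'o \<Rightarrow> real"
    and e :: "'o \<Rightarrow> 'p::polish_space"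
  assumes X: "mck_space L mk kn" and pure: "rcm_pure L mk kn" and sp: "space L = UNIV"
    and e: "e \<in> borel_measurable L" and g: "g \<in> borel \<rightarrow>\<^sub>M L" and ge: "\<And>x. g (e x) = x"
  defines "R \<equiv> distr L borel e" and "mk' \<equiv> \<lambda>\<alpha> y. mk \<alpha> (g y)" and "kn' \<equiv> \<lambda>c y y'. kn c (g y) (g y')"
  shows "borel_mck_space R mk' kn'" "rcm_pure R mk' kn'" "kernel_iso L mk kn R mk' kn'"
    "distr (PiM UNIV (\<lambda>_. L)) borel (sample_array mk kn) = distr (PiM UNIV (\<lambda>_. R)) borel (sample_array mk' kn')"
proof -
  interpret X: mck_prob_space L mk kn
    using X by (simp add: mck_prob_space_def mck_prob_space_axioms_def mck_space_def)
  interpret R: prob_space R unfolding R_def by (rule X.prob_space_distr[OF e])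
  have sR: "sets R = sets borel" by (simp add: R_def)
  have gR[measurable]: "g \<in> R \<rightarrow>\<^sub>M L" using g by (simp add: R_def)
  have eR[measurable]: "e \<in> L \<rightarrow>\<^sub>M R" using e by (simp add: R_def)
  have dR: "distr L R e = R" unfolding R_def by (intro distr_cong) auto
  have "bounded (mk' \<alpha> ` space R)" for \<alpha>
  proof (rule bounded_subset)
    show "bounded (mk \<alpha> ` space L)" using X by (simp add: mck_space_def)
  qed (auto simp: mk'_def sp)
  moreover have "bounded ((\<lambda>p. kn' c (fst p) (snd p)) ` space (R \<Otimes>\<^sub>M R))" for c
  proof (rule bounded_subset)
    show "bounded ((\<lambda>p. kn c (fst p) (snd p)) ` space (L \<Otimes>\<^sub>M L))" using X by (simp add: mck_space_def)
    show "(\<lambda>p. kn' c (fst p) (snd p)) ` space (R \<Otimes>\<^sub>M R) \<subseteq> (\<lambda>p. kn c (fst p) (snd p)) ` space (L \<Otimes>\<^sub>M L)"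
    proof (rule image_subsetI)
      fix p :: "'p \<times> 'p"
      show "kn' c (fst p) (snd p) \<in> (\<lambda>p. kn c (fst p) (snd p)) ` space (L \<Otimes>\<^sub>M L)"
        by (rule image_eqI[of _ _ "(g (fst p), g (snd p))"]) (simp_all add: kn'_def sp space_pair_measure)
    qed
  qed
  moreover have "mk' \<alpha> \<in> borel_measurable R" for \<alpha>
    unfolding mk'_def by measurable
  moreover have "(\<lambda>p. kn' c (fst p) (snd p)) \<in> borel_measurable (R \<Otimes>\<^sub>M R)" for c
    unfolding kn'_def by measurable
  ultimately have mck: "mck_space R mk' kn'"
    unfolding mck_space_def using R.prob_space_axioms by blast
  then show "borel_mck_space R mk' kn'"
    by (simp add: borel_mck_space_def mck_prob_space_def borel_mck_space_axioms_def
        mck_prob_space_axioms_def R.prob_space_axioms sR)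
  have right: "AE y in R. e (g y) = y"
  proof -
    have [measurable]: "(\<lambda>y. e (g y)) \<in> borel_measurable borel" by (rule measurable_compose[OF g e])
    have "{y \<in> space borel. e (g y) = y} = {y \<in> space borel. dist (e (g y)) y = 0}" by auto
    also have "\<dots> \<in> sets borel" by measurable
    finally show ?thesis unfolding R_def by (subst AE_distr_iff[OF e]) (auto simp: ge)
  qed
  have marks: "AE z in L. mk \<alpha> z = mk' \<alpha> (e z)" for \<alpha> by (simp add: mk'_def ge)
  have kernels: "AE p in L \<Otimes>\<^sub>M L. kn c (fst p) (snd p) = kn' c (e (fst p)) (e (snd p))" for c
    by (simp add: kn'_def ge)
  have dL: "distr R L g = L"
    unfolding R_def by (subst distr_distr[OF g e]) (simp add: comp_def ge distr_id)
  show "kernel_iso L mk kn R mk' kn'"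
    unfolding kernel_iso_def meas_iso_def
    by (intro exI[of _ e] exI[of _ g] conjI allI eR dR gR dL right marks kernels) (simp add: ge)
  show "distr (PiM UNIV (\<lambda>_. L)) borel (sample_array mk kn) = distr (PiM UNIV (\<lambda>_. R)) borel (sample_array mk' kn')"
    by (rule distr_sample_array_quotient[OF X mck eR dR marks kernels])
  show "rcm_pure R mk' kn'"
  proof -
    obtain N where N: "N \<in> null_sets L" "\<And>z z'. z \<notin> N \<Longrightarrow> z' \<notin> N \<Longrightarrow> twins L mk kn z z' \<Longrightarrow> z = z'"
      using pure by (auto simp: rcm_pure_def sp)
    obtain Z where Z: "Z \<in> null_sets R" "{y \<in> space R. \<not> e (g y) = y} \<subseteq> Z"
      using right unfolding eventually_ae_filter by blast
    have "g -` N \<inter> space R \<in> null_sets R"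
    proof (rule null_setsI)
      show "g -` N \<inter> space R \<in> sets R" using N(1) by (intro measurable_sets[OF gR]) auto
      have "emeasure R (g -` N \<inter> space R) = emeasure (distr R L g) N"
        using N(1) by (subst emeasure_distr[OF gR]) auto
      then show "emeasure R (g -` N \<inter> space R) = 0" using N(1) unfolding dL by auto
    qed
    \<comment> \<open>Besides the preimage of \<open>N\<close>, the points with
      \<open>e (g y) \<noteq> y\<close> must go: there distinct points can share a value of
      \<open>g\<close> and thus be twins.\<close>
    with Z(1) have NZ: "(g -` N \<inter> space R) \<union> Z \<in> null_sets R" by (intro null_sets.Un)
    show ?thesis
      unfolding rcm_pure_def
    proof (intro bexI[OF _ NZ] ballI impI)
      fix y y' assume y: "y \<in> space R - ((g -` N \<inter> space R) \<union> Z)" "y' \<in> space R - ((g -` N \<inter> space R) \<union> Z)"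
        and tw: "twins R mk' kn' y y'"
      have tr: "AE w in L. P (e w)" if "AE y in R. P y" for P
        using that unfolding R_def by (rule AE_distrD[OF e])
      have "twins L mk kn (g y) (g y')"
        unfolding twins_def
      proof (intro conjI allI)
        show "mk \<alpha> (g y) = mk \<alpha> (g y')" for \<alpha> using tw by (simp add: twins_def mk'_def)
        show "AE w in L. kn c (g y) w = kn c (g y') w" for c
          using tr[of "\<lambda>w. kn' c y w = kn' c y' w"] tw by (simp add: twins_def kn'_def ge)
        show "AE w in L. kn c w (g y) = kn c w (g y')" for c
          using tr[of "\<lambda>w. kn' c w y = kn' c w y'"] tw by (simp add: twins_def kn'_def ge)
      qed
      then have "g y = g y'" using y by (intro N(2)) auto
      moreover have "e (g y) = y" "e (g y') = y'" using y Z(2) by auto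
      ultimately show "y = y'" by metis
    qed
  qed
qed

section \<open>The kernel space of a joining and its finite distance arrays\<close>

lemma measurable_fst_borel: "fst \<in> (borel :: ('a::topological_space \<times> 'b::topological_space) measure) \<rightarrow>\<^sub>M borel"
  by (intro borel_measurable_continuous_onI continuous_intros)

lemma measurable_snd_borel: "snd \<in> (borel :: ('a::topological_space \<times> 'b::topological_space) measure) \<rightarrow>\<^sub>M borel"
  by (intro borel_measurable_continuous_onI continuous_intros)

lemma measurable_funpow:
  assumes "T \<in> M \<rightarrow>\<^sub>M M"
  shows "(T ^^ a) \<in> M \<rightarrow>\<^sub>M M"
proof (induction a)
  case (Suc a)
  show ?case using measurable_comp[OF Suc assms] by (simp add: comp_def)
qed (simp add: id_def)

locale dynamical_joining =
  fixes T :: "'a::metric_space \<Rightarrow> 'a" and S :: "'b::metric_space \<Rightarrow> 'b" and L :: "('a \<times> 'b) measure"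
  assumes cX: "compact (UNIV :: 'a set)" and cY: "compact (UNIV :: 'b set)"
    and T: "T \<in> borel_measurable borel" and S: "S \<in> borel_measurable borel"
    and sets_L: "sets L = sets borel" and prob_L: "prob_space L"
begin

sublocale prob_space L by (rule prob_L)

lemma space_L: "space L = UNIV"
  using sets_eq_imp_space_eq[OF sets_L] by simp

lemma measurable_orbit:
  assumes "f \<in> M \<rightarrow>\<^sub>M L"
  shows "(\<lambda>x. (T ^^ a) (fst (f x))) \<in> borel_measurable M" "(\<lambda>x. (S ^^ a) (snd (f x))) \<in> borel_measurable M"
proof -
  have f: "f \<in> borel_measurable M" using assms measurable_cong_sets[OF refl sets_L] by blast
  show "(\<lambda>x. (T ^^ a) (fst (f x))) \<in> borel_measurable M"
    by (rule measurable_compose[OF measurable_compose[OF f measurable_fst_borel] measurable_funpow[OF T]])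
  show "(\<lambda>x. (S ^^ a) (snd (f x))) \<in> borel_measurable M"
    by (rule measurable_compose[OF measurable_compose[OF f measurable_snd_borel] measurable_funpow[OF S]])
qed

lemma measurable_dist_orbit:
  assumes "f \<in> M \<rightarrow>\<^sub>M L" "h \<in> M \<rightarrow>\<^sub>M L"
  shows "(\<lambda>x. dist ((T ^^ a) (fst (f x))) ((T ^^ b) (fst (h x)))) \<in> borel_measurable M"
    "(\<lambda>x. dist ((S ^^ a) (snd (f x))) ((S ^^ b) (snd (h x)))) \<in> borel_measurable M"
  by (intro borel_measurable_dist_if_compact cX cY measurable_orbit assms)+

lemma mck_space_markK_kerK: "mck_space L (markK T S) (kerK T S)"
proof -
  obtain C where C: "\<And>x y :: 'a. dist x y \<le> C"
    using compact_imp_bounded[OF cX] by (auto simp: bounded_two_points)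
  obtain D where D: "\<And>x y :: 'b. dist x y \<le> D"
    using compact_imp_bounded[OF cY] by (auto simp: bounded_two_points)
  have "norm (markK T S \<alpha> z) \<le> max C D" for \<alpha> z
    using C D by (auto simp: markK_def le_max_iff_disj split: prod.splits)
  moreover have "norm (kerK T S c z z') \<le> max C D" for c z z'
    using C D by (auto simp: kerK_def le_max_iff_disj split: prod.splits)
  moreover have "markK T S \<alpha> \<in> borel_measurable L" for \<alpha>
    using measurable_dist_orbit[of "\<lambda>x. x" L "\<lambda>x. x"]
    by (auto simp: markK_def case_prod_beta split: prod.splits)
  moreover have "(\<lambda>p. kerK T S c (fst p) (snd p)) \<in> borel_measurable (L \<Otimes>\<^sub>M L)" for c
    using measurable_dist_orbit[OF measurable_fst measurable_snd]
    by (auto simp: kerK_def case_prod_beta split: prod.splits)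
  ultimately show ?thesis
    unfolding mck_space_def bounded_iff using prob_L by blast
qed

lemma measurable_DX_DY:
  "(\<lambda>zs. (DX T n m zs, DY S n m zs)) \<in> PiM {..<n} (\<lambda>_. L) \<rightarrow>\<^sub>M array_space n m"
proof -
  have c: "(\<lambda>zs. zs i) \<in> PiM {..<n} (\<lambda>_. L) \<rightarrow>\<^sub>M L" if "i < n" for i
    using that by (intro measurable_component_singleton) auto
  show ?thesis
    unfolding array_space_def DX_def DY_def
    by (intro measurable_Pair measurable_restrict)
      (auto simp: arr_idx_def intro!: measurable_dist_orbit c)
qed

end

text \<open>Marks sit at equal point indices, since the mark of a point is a distance between two
  times of one orbit. Kernel entries with equal point indices are 0 to agree with
  \<open>sample_array\<close>.\<close>

definition array_read :: "nat \<times> (bool \<times> nat \<times> nat) + nat \<times> nat \<times> (bool \<times> nat \<times> nat)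
    \<Rightarrow> (nat \<times> nat \<times> nat \<times> nat \<Rightarrow> real) \<times> (nat \<times> nat \<times> nat \<times> nat \<Rightarrow> real) \<Rightarrow> real" where
  "array_read e D = (case e of
     Inl (i, isX, a, b) \<Rightarrow> (if isX then fst D else snd D) (i, i, a, b)
   | Inr (i, j, isX, a, b) \<Rightarrow> if i = j then 0 else (if isX then fst D else snd D) (i, j, a, b))"

text \<open>The sum of the indices is a crude bound for each of them and \<open>Suc\<close> makes it
  strict, so for every \<open>n\<close> at least this large the coordinate lies in
  \<open>arr_idx n n\<close>.\<close>

definition array_coord_bound :: "nat \<times> (bool \<times> nat \<times> nat) + nat \<times> nat \<times> (bool \<times> nat \<times> nat) \<Rightarrow> nat" where
  "array_coord_bound e = (case e of Inl (i, isX, a, b) \<Rightarrow> Suc (i + a + b) | Inr (i, j, isX, a, b) \<Rightarrow> Suc (i + j + a + b))"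

lemma array_read_measurable:
  assumes "array_coord_bound e \<le> n"
  shows "array_read e \<in> borel_measurable (array_space n n)"
proof -
  have c: "(\<lambda>D. fst D k) \<in> borel_measurable (array_space n n)" "(\<lambda>D. snd D k) \<in> borel_measurable (array_space n n)"
    if "k \<in> arr_idx n n" for k
    unfolding array_space_def
    by (rule measurable_compose[OF measurable_fst measurable_component_singleton[OF that]],
        rule measurable_compose[OF measurable_snd measurable_component_singleton[OF that]])
  then have c': "(\<lambda>D. (if isX then fst D else snd D) k) \<in> borel_measurable (array_space n n)"
    if "k \<in> arr_idx n n" for k isX
    using that by (cases isX) auto
  show ?thesis
  proof (cases e)
    case (Inl t)
    obtain i isX a b where "t = (i, isX, a, b)" by (cases t)
    with Inl assms show ?thesis
      by (auto simp: array_read_def[abs_def] array_coord_bound_def arr_idx_def intro!: c')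
  next
    case (Inr t)
    obtain i j isX a b where "t = (i, j, isX, a, b)" by (cases t)
    with Inr assms show ?thesis
      by (cases "i = j") (auto simp: array_read_def[abs_def] array_coord_bound_def arr_idx_def intro!: c')
  qed
qed

lemma sample_array_eq_array_read:
  assumes "array_coord_bound e \<le> n"
  shows "sample_array (markK T S) (kerK T S) w e
    = array_read e (DX T n n (restrict w {..<n}), DY S n n (restrict w {..<n}))"
  using assms
  by (auto simp: sample_array_def array_read_def array_coord_bound_def markK_def kerK_def DX_def DY_def
      arr_idx_def split: sum.splits prod.splits)

text \<open>A cylinder involves finitely many entries, all visible in the finite arrays once
  \<open>n\<close> exceeds their indices; hence its mass is read off \<open>Phi\<close>.\<close>

lemma (in dynamical_joining) emeasure_sample_array_cylinder:
  assumes F: "finite F" "\<And>e. e \<in> F \<Longrightarrow> A e \<in> sets borel" and n: "\<And>e. e \<in> F \<Longrightarrow> array_coord_bound e \<le> n"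
  shows "emeasure (distr (PiM UNIV (\<lambda>_. L)) borel (sample_array (markK T S) (kerK T S))) (prod_emb UNIV (\<lambda>_. borel) F (Pi\<^sub>E F A))
    = emeasure (Phi T S n n L) {D \<in> space (array_space n n). \<forall>e\<in>F. array_read e D \<in> A e}"
proof -
  interpret K: mck_prob_space L "markK T S" "kerK T S"
    using mck_space_markK_kerK by unfold_locales
  interpret P: product_prob_space "\<lambda>_. L" "UNIV :: nat set" by unfold_locales
  let ?P = "PiM (UNIV :: nat set) (\<lambda>_. L)" and ?Pn = "PiM {..<n} (\<lambda>_. L)"
  let ?C = "{D \<in> space (array_space n n). \<forall>e\<in>F. array_read e D \<in> A e}"
  let ?D = "\<lambda>zs. (DX T n n zs, DY S n n zs)"
  have C: "?C \<in> sets (array_space n n)"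
  proof (rule sets.sets_Collect_finite_All[OF _ F(1)])
    show "{D \<in> space (array_space n n). array_read e D \<in> A e} \<in> sets (array_space n n)" if "e \<in> F" for e
      using measurable_sets[OF array_read_measurable[OF n[OF that]] F(2)[OF that]]
      by (auto simp: vimage_def Int_def conj_commute)
  qed
  have emb: "prod_emb UNIV (\<lambda>_. borel :: real measure) F (Pi\<^sub>E F A) \<in> sets borel"
  proof -
    have "prod_emb UNIV (\<lambda>_. borel :: real measure) F (Pi\<^sub>E F A) \<in> sets (PiM UNIV (\<lambda>_. borel))"
      using F by (intro sets_PiM_I) auto
    then show ?thesis unfolding sets_PiM_equal_borel .
  qed
  have r: "(\<lambda>w. restrict w {..<n}) \<in> ?P \<rightarrow>\<^sub>M ?Pn" by (rule measurable_restrict_subset) simp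
  have "emeasure (distr ?P borel (sample_array (markK T S) (kerK T S))) (prod_emb UNIV (\<lambda>_. borel) F (Pi\<^sub>E F A))
      = emeasure ?P (sample_array (markK T S) (kerK T S) -` prod_emb UNIV (\<lambda>_. borel) F (Pi\<^sub>E F A) \<inter> space ?P)"
    using emb by (subst emeasure_distr) auto
  also have "sample_array (markK T S) (kerK T S) -` prod_emb UNIV (\<lambda>_. borel) F (Pi\<^sub>E F A) \<inter> space ?P
      = (\<lambda>w. restrict w {..<n}) -` (?D -` ?C \<inter> space ?Pn) \<inter> space ?P"
  proof (intro set_eqI)
    fix w
    have "w \<in> space ?P" by (simp add: space_PiM space_L)
    moreover from measurable_space[OF r this] have "restrict w {..<n} \<in> space ?Pn" .
    moreover from measurable_space[OF measurable_DX_DY this] have "?D (restrict w {..<n}) \<in> space (array_space n n)" .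
    moreover have "(\<forall>e\<in>F. sample_array (markK T S) (kerK T S) w e \<in> A e)
        \<longleftrightarrow> (\<forall>e\<in>F. array_read e (?D (restrict w {..<n})) \<in> A e)"
      by (intro ball_cong refl) (simp add: sample_array_eq_array_read[OF n])
    ultimately show "w \<in> sample_array (markK T S) (kerK T S) -` prod_emb UNIV (\<lambda>_. borel) F (Pi\<^sub>E F A) \<inter> space ?P
      \<longleftrightarrow> w \<in> (\<lambda>w. restrict w {..<n}) -` (?D -` ?C \<inter> space ?Pn) \<inter> space ?P"
      by (simp add: prod_emb_def PiE_iff)
  qed
  also have "emeasure ?P \<dots> = emeasure (distr ?P ?Pn (\<lambda>w. restrict w {..<n})) (?D -` ?C \<inter> space ?Pn)"
    using measurable_sets[OF measurable_DX_DY C] by (subst emeasure_distr[OF r]) auto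
  also have "\<dots> = emeasure ?Pn (?D -` ?C \<inter> space ?Pn)"
    by (subst P.distr_PiM_restrict_finite) auto
  also have "\<dots> = emeasure (Phi T S n n L) ?C"
    unfolding Phi_def using C by (subst emeasure_distr[OF measurable_DX_DY]) auto
  finally show ?thesis .
qed

text \<open>Cylinders over finite index sets determine a law on the countable product, and each of
  them is visible to some \<open>Phi T S n n\<close>.\<close>

lemma sample_array_law_eq_if_Phi_eq:
  fixes T :: "'a::metric_space \<Rightarrow> 'a" and S :: "'b::metric_space \<Rightarrow> 'b"
  assumes X: "dynamical_joining T S L" and Y: "dynamical_joining T S L'"
    and Phi: "\<And>n. n \<ge> 1 \<Longrightarrow> Phi T S n n L = Phi T S n n L'"
  shows "distr (PiM UNIV (\<lambda>_. L)) borel (sample_array (markK T S) (kerK T S))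
    = distr (PiM UNIV (\<lambda>_. L')) borel (sample_array (markK T S) (kerK T S))"
proof -
  interpret X: dynamical_joining T S L by fact
  interpret Y: dynamical_joining T S L' by fact
  interpret K: mck_prob_space L "markK T S" "kerK T S"
    using X.mck_space_markK_kerK by unfold_locales
  interpret P: product_prob_space "\<lambda>_. L" "UNIV :: nat set" by unfold_locales
  show ?thesis
  proof (rule measure_eqI_PiM_infinite)
    fix A :: "_ \<Rightarrow> real set" and F :: "(nat \<times> (bool \<times> nat \<times> nat) + nat \<times> nat \<times> (bool \<times> nat \<times> nat)) set"
    assume F: "finite F" and A: "\<And>i. i \<in> F \<Longrightarrow> A i \<in> sets borel"
    \<comment> \<open>The sum dominates every single bound; \<open>Suc\<close> gives
      \<open>n \<ge> 1\<close> even for empty \<open>F\<close>, as the assumption on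
      \<open>Phi\<close> requires.\<close>
    define n where "n = Suc (\<Sum>e\<in>F. array_coord_bound e)"
    have n: "array_coord_bound e \<le> n" if "e \<in> F" for e
      using member_le_sum[OF that, of array_coord_bound] F by (simp add: n_def)
    show "emeasure (distr (PiM UNIV (\<lambda>_. L)) borel (sample_array (markK T S) (kerK T S))) (prod_emb UNIV (\<lambda>_. borel) F (Pi\<^sub>E F A))
      = emeasure (distr (PiM UNIV (\<lambda>_. L')) borel (sample_array (markK T S) (kerK T S))) (prod_emb UNIV (\<lambda>_. borel) F (Pi\<^sub>E F A))"
    proof -
      have "Phi T S n n L = Phi T S n n L'" by (rule Phi) (simp add: n_def)
      then show ?thesis
        using X.emeasure_sample_array_cylinder[of F A n] Y.emeasure_sample_array_cylinder[of F A n] F A n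
        by simp
    qed
  next
    have "prob_space (distr (PiM UNIV (\<lambda>_. L)) borel (sample_array (markK T S) (kerK T S)))"
      by (rule P.prob_space_distr) (rule K.sample_array_measurable, simp)
    then show "finite_measure (distr (PiM UNIV (\<lambda>_. L)) borel (sample_array (markK T S) (kerK T S)))"
      by (simp add: prob_space_def)
  qed (simp_all only: sets_distr sets_PiM_equal_borel)
qed

theorem theorem6:
  fixes \<mu> :: "'a::metric_space measure" and T :: "'a \<Rightarrow> 'a"
    and \<nu> :: "'b::metric_space measure" and S :: "'b \<Rightarrow> 'b"
    and lam lam' :: "('a \<times> 'b) measure"
  assumes "cmmps \<mu> T" and "cmmps \<nu> S"
    and "lam \<in> joinings \<mu> T \<nu> S" and "lam' \<in> joinings \<mu> T \<nu> S"
    and "\<forall>n\<ge>1. \<forall>m\<ge>1. Phi T S n m lam = Phi T S n m lam'"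
  shows "(\<forall>(q1 :: 'a \<times> 'b \<Rightarrow> 'c::polish_space) \<rho>1 m1 k1 (q2 :: 'a \<times> 'b \<Rightarrow> 'd::polish_space) \<rho>2 m2 k2.
            sets \<rho>1 = sets borel \<and> sets \<rho>2 = sets borel
            \<and> twin_free_quotient lam (markK T S) (kerK T S) q1 \<rho>1 m1 k1
            \<and> twin_free_quotient lam' (markK T S) (kerK T S) q2 \<rho>2 m2 k2
            \<longrightarrow> kernel_iso \<rho>1 m1 k1 \<rho>2 m2 k2)
         \<and> (da_pure T S lam \<and> da_pure T S lam' \<longrightarrow>
            kernel_iso lam (markK T S) (kerK T S) lam' (markK T S) (kerK T S))"
proof -
  interpret X: dynamical_joining T S lam
    using assms(1-3) unfolding cmmps_def joinings_def dynamical_joining_def by blast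
  interpret Y: dynamical_joining T S lam'
    using assms(1,2,4) unfolding cmmps_def joinings_def dynamical_joining_def by blast
  have law: "distr (PiM UNIV (\<lambda>_. lam)) borel (sample_array (markK T S) (kerK T S))
    = distr (PiM UNIV (\<lambda>_. lam')) borel (sample_array (markK T S) (kerK T S))"
    by (rule sample_array_law_eq_if_Phi_eq[OF X.dynamical_joining_axioms Y.dynamical_joining_axioms])
      (use assms(5) in blast)
  show ?thesis
  proof (intro conjI allI impI; elim conjE)
    fix q1 :: "'a \<times> 'b \<Rightarrow> 'c" and \<rho>1 m1 k1 and q2 :: "'a \<times> 'b \<Rightarrow> 'd" and \<rho>2 m2 k2
    assume s: "sets \<rho>1 = sets borel" "sets \<rho>2 = sets borel"
      and Q: "twin_free_quotient lam (markK T S) (kerK T S) q1 \<rho>1 m1 k1"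
        "twin_free_quotient lam' (markK T S) (kerK T S) q2 \<rho>2 m2 k2"
    have m: "mck_space \<rho>1 m1 k1" "mck_space \<rho>2 m2 k2" using Q by (auto simp: twin_free_quotient_def)
    then have b: "borel_mck_space \<rho>1 m1 k1" "borel_mck_space \<rho>2 m2 k2"
      using s by (auto simp: borel_mck_space_def borel_mck_space_axioms_def mck_prob_space_def
          mck_prob_space_axioms_def mck_space_def)
    \<comment> \<open>Passing to a quotient keeps the law of the sample array, so the laws on the
      two quotients agree; both are pure by definition and carried by Polish types, where the
      reconstruction applies directly.\<close>
    have "distr (PiM UNIV (\<lambda>_. lam)) borel (sample_array (markK T S) (kerK T S)) = distr (PiM UNIV (\<lambda>_. \<rho>1)) borel (sample_array m1 k1)"
      using Q(1) by (intro distr_sample_array_quotient[OF X.mck_space_markK_kerK m(1), of q1]) (auto simp: twin_free_quotient_def)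
    moreover have "distr (PiM UNIV (\<lambda>_. lam')) borel (sample_array (markK T S) (kerK T S)) = distr (PiM UNIV (\<lambda>_. \<rho>2)) borel (sample_array m2 k2)"
      using Q(2) by (intro distr_sample_array_quotient[OF Y.mck_space_markK_kerK m(2), of q2]) (auto simp: twin_free_quotient_def)
    ultimately show "kernel_iso \<rho>1 m1 k1 \<rho>2 m2 k2"
      using Q law by (intro kernel_iso_if_sample_array_law_eq b) (auto simp: twin_free_quotient_def)
  next
    assume pure: "da_pure T S lam" "da_pure T S lam'"
    \<comment> \<open>The joinings live on a type of class \<open>metric_space\<close> only;
      embedding it into sequences of reals supplies Polish carriers.\<close>
    have "compact (UNIV :: ('a \<times> 'b) set)"
      using compact_Times[OF X.cX X.cY] by simp
    then obtain e :: "'a \<times> 'b \<Rightarrow> nat \<Rightarrow> real" and g where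
      e: "e \<in> borel_measurable borel" "g \<in> borel_measurable borel" "\<And>x. g (e x) = x"
      by (rule borel_embedding_if_compact) blast
    have m: "e \<in> borel_measurable lam" "g \<in> borel \<rightarrow>\<^sub>M lam" "e \<in> borel_measurable lam'" "g \<in> borel \<rightarrow>\<^sub>M lam'"
      using e measurable_cong_sets[OF X.sets_L refl] measurable_cong_sets[OF refl X.sets_L]
        measurable_cong_sets[OF Y.sets_L refl] measurable_cong_sets[OF refl Y.sets_L] by blast+
    note R = kernel_iso_pure_embedding[where e=e and g=g, OF X.mck_space_markK_kerK pure(1)[unfolded da_pure_def] X.space_L m(1,2) e(3)]
    note R' = kernel_iso_pure_embedding[where e=e and g=g, OF Y.mck_space_markK_kerK pure(2)[unfolded da_pure_def] Y.space_L m(3,4) e(3)]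
    \<comment> \<open>One embedding serves both joinings, so the transported marks and kernels are
      the same functions on both sides and only the measures differ.\<close>
    let ?m = "\<lambda>\<alpha> y. markK T S \<alpha> (g y)" and ?k = "\<lambda>c y y'. kerK T S c (g y) (g y')"
    have ps: "prob_space (distr lam borel e)" "prob_space (distr lam' borel e)"
      by (rule X.prob_space_distr[OF m(1)], rule Y.prob_space_distr[OF m(3)])
    have "kernel_iso (distr lam borel e) ?m ?k (distr lam' borel e) ?m ?k"
      by (rule kernel_iso_if_sample_array_law_eq[OF R(1,2) R'(1,2)]) (simp only: R(4)[symmetric] R'(4)[symmetric] law)
    then show "kernel_iso lam (markK T S) (kerK T S) lam' (markK T S) (kerK T S)"
      by (intro kernel_iso_trans[OF X.prob_L ps(1) R(3)]
          kernel_iso_trans[OF ps(1,2) _ kernel_iso_sym[OF Y.prob_L ps(2) R'(3)]])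
  qed
qed

end
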